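(* Suppose that the copula function $C(u,v)$ has bounded first-order partial derivatives on $(0,1)^2$ and that the transformation $\phi$ admits a bounded derivative $\phi'$. Then, for any sequence of positive constants $(b_n)_{n\ge 1}$ satisfying $0<b_n<1$, $b_n\to 0$ and $b_n\ge (\log n)^{-1}$, we have almost surely, for some $c>0$, as $n\to\infty$, $$R_n\sup_{\frac{c\log n}{n}\le h\le b_n}\ \sup_{(u,v)\in(0,1)^2}\left|\hat{C}_{n,h}^{(T)}(u,v)-\mathbb{E}\hat{C}_{n,h}^{(T)}(u,v)\right|=O(1),$$ where $R_n=\left(\frac{n}{2\log\log n}\right)^{1/2}$.
   Context: Let $(X_1,Y_1),(X_2,Y_2),\dots$ be i.i.d. copies of a random vector $(X,Y)$ with joint cumulative distribution function $H$, continuous marginal distribution functions $F$ and $G$, and copula $C$, i.e. $H(x,y)=C(F(x),G(y))$. Let $F_n$, $G_n$ be the empirical distribution functions of $X_1,\dots,X_n$ and of $Y_1,\dots,Y_n$. The pseudo-observations are $\hat U_i=\frac{n}{n+1}F_n(X_i)$ and $\hat V_i=\frac{n}{n+1}G_n(Y_i)$, $1\le i\le n$. The kernel: $K$ is a univariate kernel distribution function, $K(x)=\int_{-\infty}^x k(s)\,ds$, where $k$ is a symmetric bounded kernel supported on $[-1,1]$ with $\int_{-1}^1 k(s)\,ds=1$, $\int_{-1}^1 s\,k(s)\,ds=0$ and $\int_{-1}^1 s^2k(s)\,ds\neq 0$. The transformation: $\phi$ is an increasing function on $\mathbb{R}$ with values in $[0,1]$ whose inverse $\phi^{-1}$ is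 defined on $(0,1)$ (for instance the standard Gaussian distribution function). For $0<h<1$ and $(u,v)\in(0,1)^2$ the transformation kernel estimator of the copula is $$\hat{C}_{n,h}^{(T)}(u,v)=\frac1n\sum_{i=1}^n K\left(\frac{\phi^{-1}(u)-\phi^{-1}(\hat U_i)}{h}\right)K\left(\frac{\phi^{-1}(v)-\phi^{-1}(\hat V_i)}{h}\right).$$ $\mathbb{E}\hat{C}_{n,h}^{(T)}(u,v)$ denotes its expectation for fixed $(n,h,u,v)$. Asymptotic statements concern $n$ large enough that all expressions are defined. *)

theory Defs
  imports "HOL-Probability.Probability" "HOL-Library.Landau_Symbols"
begin

definition joint_cdf :: "(real \<times> real) measure \<Rightarrow> real \<Rightarrow> real \<Rightarrow> real" where
  "joint_cdf \<mu> x y = measure \<mu> ({..x} \<times> {..y})"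

definition is_copula :: "(real \<Rightarrow> real \<Rightarrow> real) \<Rightarrow> bool" where
  "is_copula C \<longleftrightarrow>
     (\<forall>t\<in>{0..1}. C t 0 = 0 \<and> C 0 t = 0 \<and> C t 1 = t \<and> C 1 t = t) \<and>
     (\<forall>u1\<in>{0..1}. \<forall>u2\<in>{0..1}. \<forall>v1\<in>{0..1}. \<forall>v2\<in>{0..1}. u1 \<le> u2 \<longrightarrow> v1 \<le> v2 \<longrightarrow>
        C u2 v2 - C u2 v1 - C u1 v2 + C u1 v1 \<ge> 0)"

definition bounded_partials :: "(real \<Rightarrow> real \<Rightarrow> real) \<Rightarrow> bool" where
  "bounded_partials C \<longleftrightarrow> (\<exists>B. \<forall>u\<in>{0<..<1}. \<forall>v\<in>{0<..<1}.
     (\<lambda>s. C s v) differentiable (at u) \<and> \<bar>deriv (\<lambda>s. C s v) u\<bar> \<le> B \<and>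
     (\<lambda>t. C u t) differentiable (at v) \<and> \<bar>deriv (\<lambda>t. C u t) v\<bar> \<le> B)"

text \<open>No sign condition is imposed: \<open>k\<close> may take negative values.\<close>

definition is_kernel :: "(real \<Rightarrow> real) \<Rightarrow> bool" where
  "is_kernel k \<longleftrightarrow>
     k \<in> borel_measurable lebesgue \<and>
     (\<forall>s. k (- s) = k s) \<and>
     bounded (range k) \<and>
     (\<forall>s. s \<notin> {-1..1} \<longrightarrow> k s = 0) \<and>
     (LINT s:{-1..1}|lebesgue. k s) = 1 \<and>
     (LINT s:{-1..1}|lebesgue. s * k s) = 0 \<and>
     (LINT s:{-1..1}|lebesgue. s\<^sup>2 * k s) \<noteq> 0"

definition kernel_cdf :: "(real \<Rightarrow> real) \<Rightarrow> real \<Rightarrow> real" where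
  "kernel_cdf k x = (LINT s:{..x}|lebesgue. k s)"

text \<open>\<open>\<phi>\<close> need only be injective over \<open>(0,1)\<close>: it may be constant where it equals 0 or 1,
  as a distribution function with bounded support. On \<open>(0,1)\<close> the library's \<open>inv \<phi>\<close>
  is then the unique preimage.\<close>

definition is_transformation :: "(real \<Rightarrow> real) \<Rightarrow> bool" where
  "is_transformation \<phi> \<longleftrightarrow>
     mono \<phi> \<and> range \<phi> \<subseteq> {0..1} \<and> (\<forall>u\<in>{0<..<1}. \<exists>!x. \<phi> x = u)"

definition bounded_deriv :: "(real \<Rightarrow> real) \<Rightarrow> bool" where
  "bounded_deriv \<phi> \<longleftrightarrow> (\<exists>B. \<forall>x. \<phi> differentiable (at x) \<and> \<bar>deriv \<phi> x\<bar> \<le> B)"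

text \<open>Samples are sequences \<open>x\<close> indexed from 1; the first \<open>n\<close> entries are \<open>x 1, \<dots>, x n\<close>.\<close>

definition emp_cdf :: "(nat \<Rightarrow> real) \<Rightarrow> nat \<Rightarrow> real \<Rightarrow> real" where
  "emp_cdf x n t = real (card {i \<in> {1..n}. x i \<le> t}) / real n"

definition pseudo_obs :: "(nat \<Rightarrow> real) \<Rightarrow> nat \<Rightarrow> nat \<Rightarrow> real" where
  "pseudo_obs x n i = real n / (real n + 1) * emp_cdf x n (x i)"

text \<open>The value of \<open>copula_est\<close> is bounded by a constant depending only on \<open>k\<close>, because \<open>kernel_cdf k\<close> is
  bounded; real-valued suprema of its deviations over nonempty parameter ranges are therefore
  genuine suprema.\<close>

definition copula_est ::
    "(real \<Rightarrow> real) \<Rightarrow> (real \<Rightarrow> real) \<Rightarrow> (nat \<Rightarrow> real) \<Rightarrow> (nat \<Rightarrow> real) \<Rightarrow>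
     nat \<Rightarrow> real \<Rightarrow> real \<Rightarrow> real \<Rightarrow> real" where
  "copula_est k \<phi> x y n h u v =
     (1 / real n) * (\<Sum>i=1..n.
        kernel_cdf k ((inv \<phi> u - inv \<phi> (pseudo_obs x n i)) / h) *
        kernel_cdf k ((inv \<phi> v - inv \<phi> (pseudo_obs y n i)) / h))"

definition rate :: "nat \<Rightarrow> real" where
  "rate n = sqrt (real n / (2 * ln (ln (real n))))"

end

theory Submission
  imports Defs
begin

text \<open>
  Writing \<open>K((a - \<phi>\<^sup>-\<^sup>1(w)) / h)\<close> as the integral of \<open>k(s)\<close> over those \<open>s\<close> with \<open>w \<le> \<phi>(a - h s)\<close> exhibits
  the estimator as a signed mixture of values of the empirical copula of the pseudo-observations,
  with total mass at most \<open>(\<integral> |k|)\<^sup>2\<close> whatever \<open>h\<close>, \<open>u\<close>, \<open>v\<close> are. So the deviation of the estimator between two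
  samples is at most that constant times the uniform deviation of the empirical copulas, and the
  latter is controlled by the bivariate empirical process of \<open>(F(X\<^sub>i), G(Y\<^sub>i))\<close>.

  It remains to bound this process, both almost surely and in mean, by a constant times
  \<open>sqrt (n log log n)\<close> (unnormalised). Instead of a maximal inequality, the sample size is chained together with the two space
  variables: for \<open>n \<le> 4^k\<close>, dyadic boxes of mesh \<open>2^-j\<close> with \<open>j \<le> k\<close> in the three variables \<open>(n, u, v)\<close> give links that are
  centred sums of independent indicators with variance of order \<open>4^k / 2^j\<close>. All exponential
  moments of links are collected in one random variable \<open>Psi\<close> of mean at most 2; Markov's
  inequality and Borel-Cantelli over \<open>k\<close> give the almost sure bound, and \<open>ln (1 + Psi) \<le> Psi\<close> the bound in
  mean, which is needed for the expectation of the estimator.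
\<close>

subsection \<open>Moment generating functions of sums of centred indicators\<close>

text \<open>For negative \<open>x\<close> put \<open>y = - x\<close>: then
  \<open>(1 + y) * exp x \<le> 1 \<le> 1 + y ^ 3\<close>, and \<open>1 + y ^ 3\<close> has the
  factor \<open>1 + y\<close>, which cancels.\<close>

lemma exp_le_quadratic:
  fixes x :: real
  assumes "\<bar>x\<bar> \<le> 1"
  shows "exp x \<le> 1 + x + x\<^sup>2"
proof (cases "x \<ge> 0")
  case True
  then show ?thesis using assms exp_bound[of x] by simp
next
  case False
  define y where "y = - x"
  have y: "0 \<le> y" "y \<le> 1" using False assms by (auto simp: y_def)
  have "(1 + y) * exp x \<le> exp y * exp x"
    using exp_ge_add_one_self[of y] by (intro mult_right_mono) auto
  also have "\<dots> = 1" by (simp add: y_def flip: exp_add)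
  also have "1 \<le> 1 + y ^ 3" using y by simp
  also have "\<dots> = (1 + y) * (1 - y + y\<^sup>2)"
    by (simp add: algebra_simps power2_eq_square power3_eq_cube)
  finally have "exp x \<le> 1 - y + y\<^sup>2" using y by simp
  then show ?thesis by (simp add: y_def)
qed

context prob_space
begin

text \<open>On the values 0 and 1 the function \<open>exp (s * \<xi>)\<close> is affine in
  \<open>\<xi>\<close>, so the moment generating function is explicit;
  \<open>1 + x \<le> exp x\<close> and \<open>exp_le_quadratic\<close> finish. The mean takes the
  place of the variance, so indicators of small regions get a small exponent.\<close>

lemma centered_zero_one_mgf_le:
  fixes \<xi> :: "'a \<Rightarrow> real"
  assumes [measurable]: "\<xi> \<in> borel_measurable M"
    and zo: "\<And>\<omega>. \<xi> \<omega> \<in> {0, 1}"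
    and s: "\<bar>s\<bar> \<le> 1"
  shows "integrable M (\<lambda>\<omega>. exp (s * (\<xi> \<omega> - expectation \<xi>)))"
    and "expectation (\<lambda>\<omega>. exp (s * (\<xi> \<omega> - expectation \<xi>))) \<le> exp (s\<^sup>2 * expectation \<xi>)"
proof -
  define r where "r = expectation \<xi>"
  have int: "integrable M \<xi>"
    by (rule integrable_const_bound[where B = 1]) (use zo in \<open>auto intro!: AE_I2\<close>, metis abs_of_nonneg empty_iff insert_iff order_refl zero_less_one_class.zero_le_one)
  have eq: "exp (s * (\<xi> \<omega> - r)) = exp (- s * r) * (1 + (exp s - 1) * \<xi> \<omega>)" for \<omega>
    using zo[of \<omega>] by (auto simp: algebra_simps simp flip: exp_add)
  have r0: "0 \<le> r"
    unfolding r_def by (rule integral_nonneg_AE) (use zo in \<open>auto intro!: AE_I2\<close>, metis empty_iff insert_iff order_refl zero_less_one_class.zero_le_one)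
  show "integrable M (\<lambda>\<omega>. exp (s * (\<xi> \<omega> - expectation \<xi>)))"
    unfolding r_def[symmetric] eq using int by simp
  have "expectation (\<lambda>\<omega>. exp (s * (\<xi> \<omega> - r))) = exp (- s * r) * (1 + (exp s - 1) * r)"
    unfolding eq using int by (simp add: prob_space r_def)
  also have "\<dots> \<le> exp (- s * r) * exp ((exp s - 1) * r)"
    by (intro mult_left_mono exp_ge_add_one_self) auto
  also have "\<dots> = exp ((exp s - 1 - s) * r)" by (simp add: algebra_simps flip: exp_add)
  also have "\<dots> \<le> exp (s\<^sup>2 * r)"
    using exp_le_quadratic[OF s] r0 by (simp add: mult_right_mono)
  finally show "expectation (\<lambda>\<omega>. exp (s * (\<xi> \<omega> - expectation \<xi>))) \<le> exp (s\<^sup>2 * expectation \<xi>)"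
    by (simp add: r_def)
qed

lemma sum_zero_one_mgf_le:
  fixes \<xi> :: "'i \<Rightarrow> 'a \<Rightarrow> real"
  assumes fin: "finite I"
    and ind: "indep_vars (\<lambda>_. borel) \<xi> I"
    and zo: "\<And>i \<omega>. i \<in> I \<Longrightarrow> \<xi> i \<omega> \<in> {0, 1}"
    and s: "\<bar>s\<bar> \<le> 1"
    and \<sigma>: "(\<Sum>i\<in>I. expectation (\<xi> i)) \<le> \<sigma>"
  shows "integrable M (\<lambda>\<omega>. exp (s * (\<Sum>i\<in>I. \<xi> i \<omega> - expectation (\<xi> i))))"
    and "expectation (\<lambda>\<omega>. exp (s * (\<Sum>i\<in>I. \<xi> i \<omega> - expectation (\<xi> i)))) \<le> exp (s\<^sup>2 * \<sigma>)"
proof -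
  let ?f = "\<lambda>i \<omega>. exp (s * (\<xi> i \<omega> - expectation (\<xi> i)))"
  have rv: "\<xi> i \<in> borel_measurable M" if "i \<in> I" for i
    using ind that unfolding indep_vars_def by auto
  have ind': "indep_vars (\<lambda>_. borel) ?f I"
    by (rule indep_vars_compose2[OF ind]) simp
  have eq: "exp (s * (\<Sum>i\<in>I. \<xi> i \<omega> - expectation (\<xi> i))) = (\<Prod>i\<in>I. ?f i \<omega>)" for \<omega>
    by (simp add: sum_distrib_left exp_sum fin)
  have int: "integrable M (?f i)" if "i \<in> I" for i
    by (rule centered_zero_one_mgf_le(1)) (use that rv zo s in auto)
  show "integrable M (\<lambda>\<omega>. exp (s * (\<Sum>i\<in>I. \<xi> i \<omega> - expectation (\<xi> i))))"
    unfolding eq by (rule indep_vars_integrable[OF fin ind' int])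
  have "expectation (\<lambda>\<omega>. exp (s * (\<Sum>i\<in>I. \<xi> i \<omega> - expectation (\<xi> i))))
      = (\<Prod>i\<in>I. expectation (?f i))"
    unfolding eq by (rule indep_vars_lebesgue_integral[OF fin ind' int])
  also have "\<dots> \<le> (\<Prod>i\<in>I. exp (s\<^sup>2 * expectation (\<xi> i)))"
    by (intro prod_mono conjI integral_nonneg centered_zero_one_mgf_le(2)) (use rv zo s in auto)
  also have "\<dots> = exp (s\<^sup>2 * (\<Sum>i\<in>I. expectation (\<xi> i)))"
    by (simp add: exp_sum fin sum_distrib_left)
  also have "\<dots> \<le> exp (s\<^sup>2 * \<sigma>)" using \<sigma> by (simp add: mult_left_mono)
  finally show "expectation (\<lambda>\<omega>. exp (s * (\<Sum>i\<in>I. \<xi> i \<omega> - expectation (\<xi> i)))) \<le> exp (s\<^sup>2 * \<sigma>)" .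
qed

lemma sum_zero_one_abs_mgf_le:
  fixes \<xi> :: "'i \<Rightarrow> 'a \<Rightarrow> real"
  assumes "finite I"
    and "indep_vars (\<lambda>_. borel) \<xi> I"
    and "\<And>i \<omega>. i \<in> I \<Longrightarrow> \<xi> i \<omega> \<in> {0, 1}"
    and s: "0 \<le> s" "s \<le> 1"
    and "(\<Sum>i\<in>I. expectation (\<xi> i)) \<le> \<sigma>"
  shows "integrable M (\<lambda>\<omega>. exp (s * \<bar>\<Sum>i\<in>I. \<xi> i \<omega> - expectation (\<xi> i)\<bar>))"
    and "expectation (\<lambda>\<omega>. exp (s * \<bar>\<Sum>i\<in>I. \<xi> i \<omega> - expectation (\<xi> i)\<bar>)) \<le> 2 * exp (s\<^sup>2 * \<sigma>)"
proof -
  let ?S = "\<lambda>\<omega>. \<Sum>i\<in>I. \<xi> i \<omega> - expectation (\<xi> i)"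
  note mgf = sum_zero_one_mgf_le[OF assms(1-3) _ assms(6)]
  have i1: "integrable M (\<lambda>\<omega>. exp (s * ?S \<omega>))" by (rule mgf) (use s in auto)
  have i2: "integrable M (\<lambda>\<omega>. exp (- s * ?S \<omega>))" by (rule mgf) (use s in auto)
  have le: "exp (s * \<bar>x\<bar>) \<le> exp (s * x) + exp (- s * x)" for x :: real
    by (cases "x \<ge> 0") auto
  have [measurable]: "\<xi> i \<in> borel_measurable M" if "i \<in> I" for i
    using assms(2) that unfolding indep_vars_def by auto
  show int: "integrable M (\<lambda>\<omega>. exp (s * \<bar>?S \<omega>\<bar>))"
    by (rule Bochner_Integration.integrable_bound[OF Bochner_Integration.integrable_add[OF i1 i2]])
       (auto intro!: AE_I2 order_trans[OF le])
  have "expectation (\<lambda>\<omega>. exp (s * \<bar>?S \<omega>\<bar>))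
      \<le> expectation (\<lambda>\<omega>. exp (s * ?S \<omega>) + exp (- s * ?S \<omega>))"
    by (intro integral_mono int Bochner_Integration.integrable_add i1 i2 le)
  also have "\<dots> = expectation (\<lambda>\<omega>. exp (s * ?S \<omega>)) + expectation (\<lambda>\<omega>. exp (- s * ?S \<omega>))"
    by (rule Bochner_Integration.integral_add[OF i1 i2])
  also have "\<dots> \<le> exp (s\<^sup>2 * \<sigma>) + exp ((- s)\<^sup>2 * \<sigma>)"
    by (intro add_mono mgf) (use s in auto)
  finally show "expectation (\<lambda>\<omega>. exp (s * \<bar>?S \<omega>\<bar>)) \<le> 2 * exp (s\<^sup>2 * \<sigma>)" by simp
qed

end

subsection \<open>The bivariate empirical process\<close>

lemma dyadic_bracket:
  fixes x :: real
  assumes "0 \<le> x" "x \<le> 1"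
  obtains lo hi :: nat where "lo \<le> 2 ^ k" "hi \<le> 2 ^ k"
    "real lo / 2 ^ k \<le> x" "x \<le> real hi / 2 ^ k"
    "x - real lo / 2 ^ k \<le> 1 / 2 ^ k" "real hi / 2 ^ k - x \<le> 1 / 2 ^ k"
proof
  let ?y = "x * 2 ^ k"
  have y: "0 \<le> ?y" "?y \<le> 2 ^ k" using assms by auto
  have z: "\<lceil>?y\<rceil> \<le> 2 ^ k" "\<lfloor>?y\<rfloor> \<le> 2 ^ k"
    using y by (simp_all add: ceiling_le_iff order_trans[OF floor_le_ceiling])
  have lo: "real (nat \<lfloor>?y\<rfloor>) = of_int \<lfloor>?y\<rfloor>" and hi: "real (nat \<lceil>?y\<rceil>) = of_int \<lceil>?y\<rceil>"
    using y(1) by simp_all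
  show "nat \<lfloor>?y\<rfloor> \<le> 2 ^ k" "nat \<lceil>?y\<rceil> \<le> 2 ^ k"
    using z y by (auto simp: nat_le_iff)
  show "real (nat \<lfloor>?y\<rfloor>) / 2 ^ k \<le> x" "x \<le> real (nat \<lceil>?y\<rceil>) / 2 ^ k"
    unfolding lo hi by (simp_all add: divide_le_eq le_divide_eq)
  have x: "x = ?y / 2 ^ k" by simp
  have "?y - of_int \<lfloor>?y\<rfloor> \<le> 1" "of_int \<lceil>?y\<rceil> - ?y \<le> 1" by linarith+
  from this[THEN divide_right_mono[of _ _ "2 ^ k"]]
  show "x - real (nat \<lfloor>?y\<rfloor>) / 2 ^ k \<le> 1 / 2 ^ k" "real (nat \<lceil>?y\<rceil>) / 2 ^ k - x \<le> 1 / 2 ^ k"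
    unfolding lo hi by (simp_all add: diff_divide_distrib)
qed

text \<open>In the application \<open>U i\<close> and \<open>V i\<close> are \<open>F (X i)\<close>
  and \<open>G (Y i)\<close>. \<open>p\<close> plays the role of the copula, but as a distribution
  function on the whole plane, so that corners may be shifted out of the unit square.\<close>

locale uniform_pairs = prob_space M for M :: "'a measure" +
  fixes U V :: "nat \<Rightarrow> 'a \<Rightarrow> real" and p :: "real \<Rightarrow> real \<Rightarrow> real"
  assumes indep_pairs: "indep_vars (\<lambda>_. borel) (\<lambda>i \<omega>. (U i \<omega>, V i \<omega>)) {1..}"
    and prob_quadrant: "1 \<le> i \<Longrightarrow> prob {\<omega>\<in>space M. U i \<omega> \<le> u \<and> V i \<omega> \<le> v} = p u v"
    and U_unit: "U i \<omega> \<in> {0..1}" and V_unit: "V i \<omega> \<in> {0..1}"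
    and p_margin: "t \<in> {0..1} \<Longrightarrow> p t 1 = t" "t \<in> {0..1} \<Longrightarrow> p 1 t = t"
begin

definition quadrant :: "real \<Rightarrow> real \<Rightarrow> nat \<Rightarrow> 'a \<Rightarrow> real" where
  "quadrant u v i \<omega> = of_bool (U i \<omega> \<le> u \<and> V i \<omega> \<le> v)"

text \<open>The unnormalised sequential empirical process: the sample size \<open>m\<close> is a
  third index beside the corner, so that it can be chained as well.\<close>

definition dev :: "nat \<Rightarrow> real \<Rightarrow> real \<Rightarrow> 'a \<Rightarrow> real" where
  "dev m u v \<omega> = (\<Sum>i=1..m. quadrant u v i \<omega> - p u v)"

lemma quadrant_range: "0 \<le> quadrant u v i \<omega>" "quadrant u v i \<omega> \<le> 1"
  by (auto simp: quadrant_def)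

lemma quadrant_mono: "u \<le> u' \<Longrightarrow> v \<le> v' \<Longrightarrow> quadrant u v i \<omega> \<le> quadrant u' v' i \<omega>"
  by (auto simp: quadrant_def)

lemma pair_measurable: "1 \<le> i \<Longrightarrow> (\<lambda>\<omega>. (U i \<omega>, V i \<omega>)) \<in> borel_measurable M"
  using indep_pairs by (auto simp: indep_vars_def)

lemma UV_measurable:
  assumes "1 \<le> i"
  shows "U i \<in> borel_measurable M" "V i \<in> borel_measurable M"
proof -
  have m: "fst \<in> borel_measurable (borel :: (real \<times> real) measure)"
      "snd \<in> borel_measurable (borel :: (real \<times> real) measure)"
    by (auto intro!: borel_measurable_continuous_onI continuous_intros)
  show "U i \<in> borel_measurable M" "V i \<in> borel_measurable M"
    using measurable_compose[OF pair_measurable[OF assms] m(1)]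
      measurable_compose[OF pair_measurable[OF assms] m(2)] by simp_all
qed

lemma quadrant_measurable:
  assumes "1 \<le> i"
  shows "quadrant u v i \<in> borel_measurable M"
  using UV_measurable[OF assms, measurable] unfolding quadrant_def[abs_def] by measurable

lemma quadrant_integrable: "1 \<le> i \<Longrightarrow> integrable M (quadrant u v i)"
  by (rule integrable_const_bound[where B = 1]) (auto simp: quadrant_range abs_le_iff intro!: quadrant_measurable order_trans[OF _ quadrant_range(1)])

lemma expectation_quadrant:
  assumes "1 \<le> i"
  shows "expectation (quadrant u v i) = p u v"
proof -
  note UV_measurable[OF assms, measurable]
  have "expectation (quadrant u v i)
      = expectation (indicator {\<omega>\<in>space M. U i \<omega> \<le> u \<and> V i \<omega> \<le> v})"
    by (rule Bochner_Integration.integral_cong) (auto simp: quadrant_def indicator_def)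
  also have "\<dots> = p u v"
    using prob_quadrant[OF assms] by simp
  finally show ?thesis .
qed

lemma p_range: "0 \<le> p u v" "p u v \<le> 1"
  by (simp_all flip: prob_quadrant[of 1])

lemma p_mono: "u \<le> u' \<Longrightarrow> v \<le> v' \<Longrightarrow> p u v \<le> p u' v'"
  by (simp flip: expectation_quadrant[of 1]) (intro integral_mono quadrant_integrable quadrant_mono, auto)

lemma p_margin_clamp: "p t 1 = max 0 (min t 1)" "p 1 t = max 0 (min t 1)"
proof -
  have "p t 1 \<le> p 0 1" "p 1 t \<le> p 1 0" if "t < 0"
    using that by (auto intro: p_mono)
  moreover have "p 1 1 \<le> p t 1" "p 1 1 \<le> p 1 t" if "1 < t"
    using that by (auto intro: p_mono)
  ultimately show "p t 1 = max 0 (min t 1)" "p 1 t = max 0 (min t 1)"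
    using p_margin[of t] p_margin[of 0] p_margin[of 1] p_range[of t 1] p_range[of 1 t]
    by (cases "t < 0"; cases "1 < t"; force)+
qed

text \<open>A point of the larger quadrant outside the smaller one lies in a vertical or a
  horizontal strip, and the uniform margins bound the mass of each strip by its width.\<close>

lemma p_lipschitz:
  assumes "u \<le> u'" "v \<le> v'"
  shows "p u' v' \<le> p u v + (u' - u) + (v' - v)"
proof -
  note int = quadrant_integrable[of 1, OF order_refl]
  have "quadrant u' v' 1 \<omega> \<le> quadrant u v 1 \<omega> + (quadrant u' 1 1 \<omega> - quadrant u 1 1 \<omega>) + (quadrant 1 v' 1 \<omega> - quadrant 1 v 1 \<omega>)" for \<omega>
    using assms U_unit[of 1 \<omega>] V_unit[of 1 \<omega>] by (auto simp: quadrant_def of_bool_def)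
  then have "expectation (quadrant u' v' 1)
      \<le> expectation (\<lambda>\<omega>. quadrant u v 1 \<omega> + (quadrant u' 1 1 \<omega> - quadrant u 1 1 \<omega>) + (quadrant 1 v' 1 \<omega> - quadrant 1 v 1 \<omega>))"
    by (intro integral_mono int Bochner_Integration.integrable_add Bochner_Integration.integrable_diff)
  also have "\<dots> = p u v + (p u' 1 - p u 1) + (p 1 v' - p 1 v)"
    using int expectation_quadrant[of 1] by simp
  finally show ?thesis
    using assms unfolding expectation_quadrant[OF order_refl] p_margin_clamp by (auto simp: max_def min_def split: if_splits)
qed

text \<open>The count is monotone in all three arguments, so only the change of the centring
  \<open>m * p u v\<close> has to be paid for. This lets grid values bracket \<open>dev\<close>
  everywhere.\<close>

lemma dev_mono_approx:
  assumes le: "m \<le> m'" "u \<le> u'" "v \<le> v'"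
  shows "dev m u v \<omega> \<le> dev m' u' v' \<omega> + (real m' - real m) + real m * ((u' - u) + (v' - v))"
proof -
  have "(\<Sum>i=1..m. quadrant u v i \<omega>) \<le> (\<Sum>i=1..m. quadrant u' v' i \<omega>)"
    by (intro sum_mono quadrant_mono le)
  also have "\<dots> \<le> (\<Sum>i=1..m'. quadrant u' v' i \<omega>)"
    by (intro sum_mono2) (use le quadrant_range in auto)
  finally have cnt: "(\<Sum>i=1..m. quadrant u v i \<omega>) \<le> (\<Sum>i=1..m'. quadrant u' v' i \<omega>)" .
  have "(real m' - real m) * p u' v' \<le> (real m' - real m) * 1"
    by (intro mult_left_mono p_range) (use le in auto)
  moreover have "real m * p u' v' \<le> real m * (p u v + (u' - u) + (v' - v))"
    by (intro mult_left_mono p_lipschitz le) auto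
  ultimately have "real m' * p u' v' - real m * p u v
      \<le> (real m' - real m) + real m * ((u' - u) + (v' - v))"
    by (simp add: algebra_simps)
  with cnt show ?thesis by (simp add: dev_def sum_subtractf)
qed

text \<open>For nested corners the increment is again a centred sum of independent indicators: an
  L-shaped region for \<open>i \<le> m'\<close>, a whole quadrant for later \<open>i\<close>. Its
  total mean \<open>m * p u v - m' * p u' v'\<close> is at most \<open>\<sigma>\<close> by
  \<open>p_lipschitz\<close>.\<close>

lemma dev_increment_mgf:
  assumes le: "m' \<le> m" "u' \<le> u" "v' \<le> v" and s: "0 \<le> s" "s \<le> 1"
    and \<sigma>: "real m * ((u - u') + (v - v')) + (real m - real m') \<le> \<sigma>"
  shows "integrable M (\<lambda>\<omega>. exp (s * \<bar>dev m u v \<omega> - dev m' u' v' \<omega>\<bar>))"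
    and "expectation (\<lambda>\<omega>. exp (s * \<bar>dev m u v \<omega> - dev m' u' v' \<omega>\<bar>)) \<le> 2 * exp (s\<^sup>2 * \<sigma>)"
proof -
  define \<xi> where "\<xi> i \<omega> = quadrant u v i \<omega> - (if i \<le> m' then quadrant u' v' i \<omega> else 0)" for i \<omega>
  \<comment> \<open>\<open>g i\<close> exhibits \<open>\<xi> i\<close> as a measurable function of
    the pair number \<open>i\<close>, so independence of the pairs carries over.\<close>
  define g where "g i z = of_bool (fst z \<le> u \<and> snd z \<le> v)
      - (if i \<le> m' then of_bool (fst z \<le> u' \<and> snd z \<le> v') else 0 :: real)"
    for i :: nat and z :: "real \<times> real"
  have E: "expectation (\<xi> i) = p u v - (if i \<le> m' then p u' v' else 0)" if "i \<in> {1..m}" for i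
  proof -
    have "1 \<le> i" using that by auto
    then show ?thesis
      by (cases "i \<le> m'")
         (simp_all add: \<xi>_def[abs_def] Bochner_Integration.integral_diff[OF quadrant_integrable quadrant_integrable]
           expectation_quadrant)
  qed
  have restr: "(\<Sum>i=1..m. if i \<le> m' then f i else 0) = (\<Sum>i=1..m'. f i)" for f :: "nat \<Rightarrow> real"
    using le(1) by (intro sum.mono_neutral_cong_right) auto
  have eq: "(\<Sum>i=1..m. \<xi> i \<omega> - expectation (\<xi> i)) = dev m u v \<omega> - dev m' u' v' \<omega>" for \<omega>
  proof -
    have "(\<Sum>i=1..m. \<xi> i \<omega> - expectation (\<xi> i))
        = (\<Sum>i=1..m. (quadrant u v i \<omega> - p u v) - (if i \<le> m' then quadrant u' v' i \<omega> - p u' v' else 0))"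
      by (intro sum.cong refl) (auto simp: E \<xi>_def)
    also have "\<dots> = dev m u v \<omega> - dev m' u' v' \<omega>"
      unfolding sum_subtractf restr dev_def ..
    finally show ?thesis .
  qed
  have fin: "finite {1..m}" by simp
  have ind: "indep_vars (\<lambda>_. borel) \<xi> {1..m}"
  proof -
    have [measurable]: "fst \<in> borel_measurable (borel :: (real \<times> real) measure)"
        "snd \<in> borel_measurable (borel :: (real \<times> real) measure)"
      by (auto intro!: borel_measurable_continuous_onI continuous_intros)
    have "indep_vars (\<lambda>_. borel) (\<lambda>i \<omega>. g i (U i \<omega>, V i \<omega>)) {1..m}"
      by (rule indep_vars_compose2[OF indep_vars_subset[OF indep_pairs]]) (auto simp: g_def[abs_def])
    then show ?thesis unfolding g_def \<xi>_def[abs_def] quadrant_def fst_conv snd_conv .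
  qed
  have zo: "\<xi> i \<omega> \<in> {0, 1}" if "i \<in> {1..m}" for i \<omega>
    using le by (auto simp: \<xi>_def quadrant_def)
  have "(\<Sum>i=1..m. expectation (\<xi> i)) = real m * p u v - real m' * p u' v'"
  proof -
    have "(\<Sum>i=1..m. expectation (\<xi> i)) = (\<Sum>i=1..m. p u v - (if i \<le> m' then p u' v' else 0))"
      by (intro sum.cong refl E)
    also have "\<dots> = real m * p u v - real m' * p u' v'"
      unfolding sum_subtractf restr by simp
    finally show ?thesis .
  qed
  also have "\<dots> \<le> \<sigma>"
  proof -
    have "real m * p u v \<le> real m * (p u' v' + (u - u') + (v - v'))"
      by (intro mult_left_mono p_lipschitz le) auto
    moreover have "(real m - real m') * p u' v' \<le> (real m - real m') * 1"
      by (intro mult_left_mono p_range) (use le in auto)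
    ultimately show ?thesis using \<sigma> by (simp add: algebra_simps)
  qed
  finally have var: "(\<Sum>i=1..m. expectation (\<xi> i)) \<le> \<sigma>" .
  show "integrable M (\<lambda>\<omega>. exp (s * \<bar>dev m u v \<omega> - dev m' u' v' \<omega>\<bar>))"
    and "expectation (\<lambda>\<omega>. exp (s * \<bar>dev m u v \<omega> - dev m' u' v' \<omega>\<bar>)) \<le> 2 * exp (s\<^sup>2 * \<sigma>)"
    using sum_zero_one_abs_mgf_le[OF fin ind zo s var] unfolding eq by auto
qed

end

subsection \<open>Chaining over dyadic boxes in time and space\<close>

lemma sum_Suc_times_power_le:
  fixes r :: real
  assumes "0 \<le> r" "r < 1"
  shows "(\<Sum>l\<le>j. real (Suc l) * r ^ l) \<le> 1 / (1 - r)\<^sup>2"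
proof -
  have s: "(\<lambda>l. real (Suc l) * r ^ l) sums (1 / (1 - r)\<^sup>2)"
    using geometric_deriv_sums[of r] assms by simp
  have "(\<Sum>l\<le>j. real (Suc l) * r ^ l) \<le> (\<Sum>l. real (Suc l) * r ^ l)"
    by (rule sum_le_suminf) (use s assms in \<open>auto simp: sums_iff\<close>)
  with s show ?thesis by (simp add: sums_iff)
qed

text \<open>Rounding a point of the level \<open>j\<close> grid down to level \<open>j - 1\<close>
  costs at most one step of level \<open>j\<close>. At \<open>j = 0\<close> the truncated
  \<open>j - 1\<close> is 0 and the point, 0 or 1, is rounded to 0.\<close>

lemma half_div_diff:
  assumes "b \<le> 2 ^ j"
  shows "real (b div 2) / 2 ^ (j - 1) \<le> real b / 2 ^ j"
    and "real b / 2 ^ j - real (b div 2) / 2 ^ (j - 1) \<le> 1 / 2 ^ j"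
proof -
  have eq: "real b = 2 * real (b div 2) + real (b mod 2)"
    by (metis of_nat_add of_nat_mult of_nat_numeral mult_div_mod_eq)
  have "real (b mod 2) \<le> 1" by (simp add: mod2_eq_if)
  then have "real (b div 2) / 2 ^ (j - 1) \<le> real b / 2 ^ j \<and>
      real b / 2 ^ j - real (b div 2) / 2 ^ (j - 1) \<le> 1 / 2 ^ j"
    using assms unfolding eq by (cases j) (auto simp: field_simps le_Suc_eq)
  then show "real (b div 2) / 2 ^ (j - 1) \<le> real b / 2 ^ j"
    and "real b / 2 ^ j - real (b div 2) / 2 ^ (j - 1) \<le> 1 / 2 ^ j" by auto
qed

section \<open>Grid points, parents and links\<close>

context uniform_pairs
begin

text \<open>The time step \<open>2 ^ (2 * k - j)\<close> is \<open>4 ^ k / 2 ^ j\<close> as a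
  natural number: sample sizes up to \<open>4 ^ k\<close> are cut into \<open>2 ^ j\<close> pieces,
  just like the two space axes.\<close>

definition grid :: "nat \<Rightarrow> nat \<Rightarrow> nat \<times> nat \<times> nat \<Rightarrow> 'a \<Rightarrow> real" where
  "grid k j = (\<lambda>(a, b, c). dev (a * 2 ^ (2 * k - j)) (real b / 2 ^ j) (real c / 2 ^ j))"

definition parent :: "nat \<times> nat \<times> nat \<Rightarrow> nat \<times> nat \<times> nat" where
  "parent = (\<lambda>(a, b, c). (a div 2, b div 2, c div 2))"

definition cells :: "nat \<Rightarrow> (nat \<times> nat \<times> nat) set" where
  "cells j = {..2 ^ j} \<times> {..2 ^ j} \<times> {..2 ^ j}"

text \<open>At level 0 the truncated index \<open>j - 1\<close> is harmless: the parent of a cell of level 0 is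
  \<open>(0, 0, 0)\<close>, where \<open>grid\<close> vanishes, so the link is the grid value itself.\<close>

definition link :: "nat \<Rightarrow> nat \<Rightarrow> nat \<times> nat \<times> nat \<Rightarrow> 'a \<Rightarrow> real" where
  "link k j q \<omega> = grid k j q \<omega> - grid k (j - 1) (parent q) \<omega>"

text \<open>The factor 3 counts the coordinates: each of them moves by at most
  \<open>1 / 2 ^ j\<close> of its range and thereby adds at most \<open>4 ^ k / 2 ^ j\<close> to the
  total mean.\<close>

definition link_var :: "nat \<Rightarrow> nat \<Rightarrow> real" where
  "link_var k j = 3 * 4 ^ k / 2 ^ j"

lemma link_var_pos: "0 < link_var k j"
  by (simp add: link_var_def)

lemma finite_cells [simp]: "finite (cells j)"
  by (simp add: cells_def)

lemma card_cells_le: "real (card (cells j)) \<le> 8 ^ Suc j"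
proof -
  have "real (card (cells j)) = (2 ^ j + 1) ^ 3"
    by (simp add: cells_def card_cartesian_product power3_eq_cube algebra_simps)
  also have "\<dots> \<le> (2 * 2 ^ j) ^ 3" by (intro power_mono) auto
  also have "\<dots> = (2 ^ 3) ^ Suc j"
    by (simp only: power_Suc[symmetric] power_mult[symmetric] mult.commute)
  also have "\<dots> = 8 ^ Suc j" by simp
  finally show ?thesis .
qed

lemma link_mgf:
  assumes j: "j \<le> k" and q: "q \<in> cells j" and s: "0 \<le> s" "s \<le> 1"
  shows "integrable M (\<lambda>\<omega>. exp (s * \<bar>link k j q \<omega>\<bar>))"
    and "expectation (\<lambda>\<omega>. exp (s * \<bar>link k j q \<omega>\<bar>)) \<le> 2 * exp (s\<^sup>2 * link_var k j)"
proof -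
  obtain a b c where q_eq: "q = (a, b, c)" by (cases q)
  have le: "a \<le> 2 ^ j" "b \<le> 2 ^ j" "c \<le> 2 ^ j" using q by (auto simp: q_eq cells_def)
  define m m' where "m = a * 2 ^ (2 * k - j)" and "m' = a div 2 * 2 ^ (2 * k - (j - 1))"
  have four: "(2::real) ^ (2 * k) = 4 ^ k" by (simp add: power_mult)
  have pw: "(2::real) ^ (2 * k - i) = 4 ^ k / 2 ^ i" if "i \<le> 2 * k" for i
    unfolding four[symmetric] using that by (simp add: power_diff)
  have m_eq: "real m = 4 ^ k * (real a / 2 ^ j)"
    using j by (simp add: m_def pw)
  have m'_eq: "real m' = 4 ^ k * (real (a div 2) / 2 ^ (j - 1))"
    using j by (simp add: m'_def pw)
  have le_m: "m' \<le> m"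
    using mult_left_mono[OF half_div_diff(1)[OF le(1)], of "4 ^ k"]
    unfolding of_nat_le_iff[where 'a = real, symmetric] m_eq m'_eq by simp
  have diff_m: "real m - real m' \<le> 4 ^ k * (1 / 2 ^ j)"
    unfolding m_eq m'_eq right_diff_distrib[symmetric]
    by (intro mult_left_mono half_div_diff le) auto
  have "real m \<le> 4 ^ k * 1"
    unfolding m_eq using le(1) by (intro mult_left_mono) auto
  moreover have "(real b / 2 ^ j - real (b div 2) / 2 ^ (j - 1)) +
      (real c / 2 ^ j - real (c div 2) / 2 ^ (j - 1)) \<le> 2 / 2 ^ j" (is "?d \<le> _")
    using half_div_diff(2)[OF le(2)] half_div_diff(2)[OF le(3)] by simp
  moreover have "0 \<le> ?d"
    using half_div_diff(1)[OF le(2)] half_div_diff(1)[OF le(3)] by simp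
  ultimately have "real m * ?d \<le> 4 ^ k * (2 / 2 ^ j)"
    by (intro mult_mono) auto
  with diff_m have var: "real m * ?d + (real m - real m') \<le> link_var k j"
    by (simp add: link_var_def)
  show "integrable M (\<lambda>\<omega>. exp (s * \<bar>link k j q \<omega>\<bar>))"
    and "expectation (\<lambda>\<omega>. exp (s * \<bar>link k j q \<omega>\<bar>)) \<le> 2 * exp (s\<^sup>2 * link_var k j)"
    using dev_increment_mgf[OF le_m half_div_diff(1)[OF le(2)] half_div_diff(1)[OF le(3)] s var]
    unfolding link_def grid_def parent_def q_eq m_def m'_def by simp_all
qed

text \<open>The tilt \<open>\<theta> / sqrt (link_var k j)\<close> gives all levels the same
  exponent \<open>\<theta>\<^sup>2\<close>, which is subtracted. The discount
  \<open>4 * Suc j\<close> is worth a factor of at most \<open>(1 / 16) ^ Suc j\<close> and so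
  outweighs the at most \<open>8 ^ Suc j\<close> cells of level \<open>j\<close>.\<close>

definition Psi :: "nat \<Rightarrow> real \<Rightarrow> 'a \<Rightarrow> real" where
  "Psi k \<theta> \<omega> = (\<Sum>j\<le>k. \<Sum>q\<in>cells j.
     exp (\<theta> / sqrt (link_var k j) * \<bar>link k j q \<omega>\<bar> - (\<theta>\<^sup>2 + 4 * real (Suc j))))"

lemma Psi_nonneg: "0 \<le> Psi k \<theta> \<omega>"
  by (simp add: Psi_def sum_nonneg)

text \<open>The smallest variance bound is \<open>link_var k k = 3 * 2 ^ k\<close>. The condition on
  \<open>\<theta>\<close> thus keeps the tilt at most 1 on every level, as the moment bound demands;
  this is why chaining stops at level \<open>k\<close>.\<close>

lemma Psi_expectation:
  assumes \<theta>: "0 \<le> \<theta>" "\<theta>\<^sup>2 \<le> 3 * 2 ^ k"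
  shows "integrable M (Psi k \<theta>)" and "expectation (Psi k \<theta>) \<le> 2"
proof -
  define s where "s j = \<theta> / sqrt (link_var k j)" for j
  have s: "0 \<le> s j" "s j \<le> 1" "(s j)\<^sup>2 * link_var k j = \<theta>\<^sup>2" if "j \<le> k" for j
  proof -
    show "0 \<le> s j" using \<theta> link_var_pos[of k j] by (simp add: s_def)
    have "(2::real) ^ j \<le> 2 ^ k" using that by simp
    then have "2 ^ k * (2::real) ^ j \<le> 2 ^ k * 2 ^ k" by (intro mult_left_mono) auto
    then have "3 * 2 ^ k \<le> link_var k j"
      by (simp add: link_var_def field_simps flip: power_mult_distrib)
    with \<theta> have "\<theta>\<^sup>2 \<le> link_var k j" by simp
    then have "\<theta> \<le> sqrt (link_var k j)" by (rule real_le_rsqrt)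
    then show "s j \<le> 1" using link_var_pos[of k j] by (simp add: s_def)
    show "(s j)\<^sup>2 * link_var k j = \<theta>\<^sup>2"
      using link_var_pos[of k j] by (simp add: s_def power_divide)
  qed
  let ?f = "\<lambda>j q \<omega>. exp (s j * \<bar>link k j q \<omega>\<bar> - (\<theta>\<^sup>2 + 4 * real (Suc j)))"
  have f_eq: "?f j q = (\<lambda>\<omega>. exp (s j * \<bar>link k j q \<omega>\<bar>) * exp (- (\<theta>\<^sup>2 + 4 * real (Suc j))))" for j q
    unfolding exp_add[symmetric] diff_conv_add_uminus ..
  have int: "integrable M (?f j q)" if "j \<le> k" "q \<in> cells j" for j q
    unfolding f_eq using link_mgf(1)[OF that s(1,2)] that by simp
  have Psi_eq: "Psi k \<theta> = (\<lambda>\<omega>. \<Sum>j\<le>k. \<Sum>q\<in>cells j. ?f j q \<omega>)"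
    by (simp add: Psi_def[abs_def] s_def)
  show "integrable M (Psi k \<theta>)"
    unfolding Psi_eq by (intro Bochner_Integration.integrable_sum int) auto
  have exp4: "exp (- (4 * real n)) \<le> (1 / 16) ^ n" for n
  proof -
    have "(16::real) = 2 ^ 4" by simp
    also have "\<dots> \<le> exp 1 ^ 4" using exp_ge_add_one_self[of 1] by (intro power_mono) auto
    finally have "16 \<le> exp (4::real)" by (simp flip: exp_of_nat_mult)
    then have "exp (- 4) \<le> (1 / 16 :: real)" by (simp add: exp_minus field_simps)
    then have "exp (- 4) ^ n \<le> (1 / 16 :: real) ^ n" by (intro power_mono) auto
    then show ?thesis by (simp add: mult.commute flip: exp_of_nat_mult)
  qed
  have E: "expectation (?f j q) \<le> 2 * (1 / 16) ^ Suc j" if "j \<le> k" "q \<in> cells j" for j q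
  proof -
    have "expectation (?f j q)
        = expectation (\<lambda>\<omega>. exp (s j * \<bar>link k j q \<omega>\<bar>)) * exp (- (\<theta>\<^sup>2 + 4 * real (Suc j)))"
      unfolding f_eq by simp
    also have "\<dots> \<le> (2 * exp (\<theta>\<^sup>2)) * exp (- (\<theta>\<^sup>2 + 4 * real (Suc j)))"
      using link_mgf(2)[OF that s(1,2)[OF that(1)]] s(3)[OF that(1)] by (intro mult_right_mono) auto
    also have "\<dots> = 2 * exp (- (4 * real (Suc j)))" by (simp flip: exp_add)
    also have "\<dots> \<le> 2 * (1 / 16) ^ Suc j" by (intro mult_left_mono exp4) auto
    finally show ?thesis .
  qed
  have "expectation (Psi k \<theta>) = (\<Sum>j\<le>k. \<Sum>q\<in>cells j. expectation (?f j q))"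
    unfolding Psi_eq using int
    by (subst Bochner_Integration.integral_sum)
       (auto intro!: Bochner_Integration.integrable_sum sum.cong Bochner_Integration.integral_sum)
  also have "\<dots> \<le> (\<Sum>j\<le>k. \<Sum>q\<in>cells j. 2 * (1 / 16) ^ Suc j)"
    by (intro sum_mono E) auto
  also have "\<dots> = (\<Sum>j\<le>k. real (card (cells j)) * (2 * (1 / 16) ^ Suc j))" by simp
  also have "\<dots> \<le> (\<Sum>j\<le>k. 8 ^ Suc j * (2 * (1 / 16) ^ Suc j))"
    by (intro sum_mono mult_right_mono card_cells_le) auto
  also have "\<dots> = (\<Sum>j\<le>k. (1 / 2) ^ j)"
    by (intro sum.cong) (simp_all add: power_divide field_simps flip: power_mult_distrib)
  also have "\<dots> = 2 - (1 / 2) ^ k" by (induction k) auto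
  also have "\<dots> \<le> 2" by simp
  finally show "expectation (Psi k \<theta>) \<le> 2" .
qed

text \<open>Each summand is at most the whole sum; take logarithms. The added 1 keeps the logarithm
  nonnegative.\<close>

lemma link_le_Psi:
  assumes "0 < \<theta>" "j \<le> k" "q \<in> cells j"
  shows "\<bar>link k j q \<omega>\<bar> \<le> sqrt (link_var k j) / \<theta> * (\<theta>\<^sup>2 + 4 * real (Suc j) + ln (1 + Psi k \<theta> \<omega>))"
proof -
  define s where "s = \<theta> / sqrt (link_var k j)"
  have s: "0 < s" using assms link_var_pos[of k j] by (simp add: s_def)
  have "exp (s * \<bar>link k j q \<omega>\<bar> - (\<theta>\<^sup>2 + 4 * real (Suc j)))
      \<le> (\<Sum>q\<in>cells j. exp (s * \<bar>link k j q \<omega>\<bar> - (\<theta>\<^sup>2 + 4 * real (Suc j))))"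
    using assms by (intro member_le_sum) auto
  also have "\<dots> \<le> Psi k \<theta> \<omega>"
    unfolding Psi_def s_def
    by (rule member_le_sum[where f = "\<lambda>j. \<Sum>q\<in>cells j. exp (\<theta> / sqrt (link_var k j) * \<bar>link k j q \<omega>\<bar> - (\<theta>\<^sup>2 + 4 * real (Suc j)))"])
       (use assms in \<open>auto intro: sum_nonneg\<close>)
  also have "\<dots> \<le> 1 + Psi k \<theta> \<omega>" by simp
  finally have "s * \<bar>link k j q \<omega>\<bar> - (\<theta>\<^sup>2 + 4 * real (Suc j)) \<le> ln (1 + Psi k \<theta> \<omega>)"
    using Psi_nonneg[of k \<theta> \<omega>] by (simp add: ln_ge_iff)
  then have "\<bar>link k j q \<omega>\<bar> \<le> (\<theta>\<^sup>2 + 4 * real (Suc j) + ln (1 + Psi k \<theta> \<omega>)) / s"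
    using s by (simp add: field_simps)
  then show ?thesis by (simp add: s_def mult.commute)
qed

text \<open>Since 3 is at most 4 and 1/2 at most 9/16, the irrational decay rate can be replaced by
  3/4, for which the series over the levels has an explicit bound.\<close>

lemma sqrt_link_var_le: "sqrt (link_var k j) \<le> 2 * 2 ^ k * (3 / 4) ^ j"
proof (rule real_le_lsqrt)
  have "link_var k j = 3 * 4 ^ k * (1 / 2) ^ j" by (simp add: link_var_def power_divide)
  also have "\<dots> \<le> 4 * 4 ^ k * (9 / 16) ^ j"
    by (intro mult_mono power_mono) auto
  also have "\<dots> = (2 * 2 ^ k * (3 / 4) ^ j)\<^sup>2"
  proof -
    have "(4::real) ^ k = 2 ^ k * 2 ^ k" "(9 / 16 :: real) ^ j = (3 / 4) ^ j * (3 / 4) ^ j"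
      by (simp_all flip: power_mult_distrib)
    then show ?thesis by (simp add: power2_eq_square)
  qed
  finally show "link_var k j \<le> (2 * 2 ^ k * (3 / 4) ^ j)\<^sup>2" .
qed (use link_var_pos in \<open>auto simp: less_imp_le\<close>)

text \<open>Telescope along parents down to level 0 and sum the link bounds. The constant is
  \<open>2 * 16 * 5\<close>: 2 from \<open>sqrt_link_var_le\<close>, 16 from the series with ratio
  3/4, and 5 from absorbing \<open>4 * Suc l\<close> into \<open>\<theta>\<^sup>2 * Suc l\<close>,
  which uses \<open>1 \<le> \<theta>\<close>.\<close>

lemma grid_le_Psi:
  assumes \<theta>: "1 \<le> \<theta>" and q: "q \<in> cells k"
  shows "\<bar>grid k k q \<omega>\<bar> \<le> 160 * 2 ^ k * (\<theta> + ln (1 + Psi k \<theta> \<omega>) / \<theta>)"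
proof -
  define L where "L = ln (1 + Psi k \<theta> \<omega>)"
  define \<beta> where "\<beta> l = sqrt (link_var k l) / \<theta> * (\<theta>\<^sup>2 + 4 * real (Suc l) + L)" for l
  have L: "0 \<le> L" using Psi_nonneg[of k \<theta> \<omega>] by (simp add: L_def)
  have link: "\<bar>link k j q \<omega>\<bar> \<le> \<beta> j" if "j \<le> k" "q \<in> cells j" for j q
    using link_le_Psi[of \<theta> j k q \<omega>] that \<theta> by (simp add: \<beta>_def L_def)
  have "\<bar>grid k j q \<omega>\<bar> \<le> (\<Sum>l\<le>j. \<beta> l)" if "j \<le> k" "q \<in> cells j" for j q
    using that
  proof (induction j arbitrary: q)
    case 0
    have "grid k 0 (parent q) \<omega> = 0"
      using 0 by (auto simp: cells_def parent_def grid_def dev_def)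
    with link[OF 0] show ?case by (simp add: link_def)
  next
    case (Suc j)
    have "parent q \<in> cells j" using Suc.prems by (auto simp: cells_def parent_def)
    then have "\<bar>grid k j (parent q) \<omega>\<bar> \<le> (\<Sum>l\<le>j. \<beta> l)" using Suc by auto
    with link[OF Suc.prems] show ?case by (simp add: link_def)
  qed
  from this[OF order_refl q] have "\<bar>grid k k q \<omega>\<bar> \<le> (\<Sum>l\<le>k. \<beta> l)" .
  also have "\<dots> \<le> (\<Sum>l\<le>k. 2 * 2 ^ k * (5 * \<theta> + L / \<theta>) * (real (Suc l) * (3 / 4) ^ l))"
  proof (rule sum_mono)
    fix l
    have "\<theta>\<^sup>2 + 4 * real (Suc l) + L \<le> (5 * \<theta>\<^sup>2 + L) * real (Suc l)"
    proof -
      have "4 * real (Suc l) * 1 \<le> 4 * real (Suc l) * \<theta>\<^sup>2"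
        using \<theta> by (intro mult_left_mono) auto
      moreover have "(\<theta>\<^sup>2 + L) * 1 \<le> (\<theta>\<^sup>2 + L) * real (Suc l)"
        using L by (intro mult_left_mono) auto
      ultimately show ?thesis by (simp add: algebra_simps)
    qed
    then have "\<beta> l \<le> sqrt (link_var k l) / \<theta> * ((5 * \<theta>\<^sup>2 + L) * real (Suc l))"
      unfolding \<beta>_def using \<theta> link_var_pos[of k l] by (intro mult_left_mono) auto
    also have "\<dots> \<le> (2 * 2 ^ k * (3 / 4) ^ l) / \<theta> * ((5 * \<theta>\<^sup>2 + L) * real (Suc l))"
      using \<theta> L by (intro mult_right_mono divide_right_mono sqrt_link_var_le) auto
    also have "\<dots> = 2 * 2 ^ k * (5 * \<theta> + L / \<theta>) * (real (Suc l) * (3 / 4) ^ l)"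
      using \<theta> by (simp add: field_simps power2_eq_square)
    finally show "\<beta> l \<le> 2 * 2 ^ k * (5 * \<theta> + L / \<theta>) * (real (Suc l) * (3 / 4) ^ l)" .
  qed
  also have "\<dots> = 2 * 2 ^ k * (5 * \<theta> + L / \<theta>) * (\<Sum>l\<le>k. real (Suc l) * (3 / 4) ^ l)"
    by (simp add: sum_distrib_left)
  also have "\<dots> \<le> 2 * 2 ^ k * (5 * \<theta> + L / \<theta>) * 16"
  proof (rule mult_left_mono)
    show "(\<Sum>l\<le>k. real (Suc l) * (3 / 4) ^ l) \<le> 16"
      using sum_Suc_times_power_le[of "3 / 4" k] by (simp add: power2_eq_square)
  qed (use \<theta> L in auto)
  also have "\<dots> = 32 * 2 ^ k * (5 * \<theta> + L / \<theta>)" by simp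
  also have "\<dots> \<le> 32 * 2 ^ k * (5 * (\<theta> + L / \<theta>))"
  proof (rule mult_left_mono)
    show "5 * \<theta> + L / \<theta> \<le> 5 * (\<theta> + L / \<theta>)"
      unfolding distrib_left using mult_right_mono[of 1 5 "L / \<theta>"] \<theta> L by simp
  qed simp
  also have "\<dots> = 160 * 2 ^ k * (\<theta> + L / \<theta>)" by simp
  finally show ?thesis by (simp add: L_def)
qed

text \<open>With \<open>dev_min_1\<close> this reduces arbitrary real corners to the unit
  square.\<close>

lemma dev_eq_0: "u < 0 \<or> v < 0 \<Longrightarrow> dev m u v \<omega> = 0"
proof -
  assume neg: "u < 0 \<or> v < 0"
  have "quadrant u v i = (\<lambda>_. 0)" for i
  proof
    show "quadrant u v i \<omega> = 0" for \<omega>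
      using neg U_unit[of i \<omega>] V_unit[of i \<omega>] by (auto simp: quadrant_def)
  qed
  moreover from this have "p u v = 0"
    using expectation_quadrant[of 1 u v] by simp
  ultimately show "dev m u v \<omega> = 0" by (simp add: dev_def)
qed

lemma dev_min_1: "dev m (min u 1) (min v 1) = dev m u v"
proof -
  have q: "quadrant (min u 1) (min v 1) i = quadrant u v i" for i
    using U_unit V_unit by (auto simp: quadrant_def fun_eq_iff)
  moreover from this have "p (min u 1) (min v 1) = p u v"
    using expectation_quadrant[of 1] by (metis order_refl)
  ultimately show ?thesis by (simp add: dev_def[abs_def])
qed

text \<open>Bracket \<open>(m, u, v)\<close> between grid points of level \<open>k\<close>. The time
  step is \<open>2 ^ k\<close> and each space step \<open>1 / 2 ^ k\<close> is weighted by at most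
  \<open>4 ^ k\<close>, so the error is at most \<open>3 * 2 ^ k\<close>; as
  \<open>1 \<le> \<theta>\<close>, this raises 160 to 163.\<close>

lemma dev_le_Psi:
  assumes \<theta>: "1 \<le> \<theta>" and m: "m \<le> 4 ^ k"
  shows "\<bar>dev m u v \<omega>\<bar> \<le> 163 * 2 ^ k * (\<theta> + ln (1 + Psi k \<theta> \<omega>) / \<theta>)"
proof -
  define L where "L = ln (1 + Psi k \<theta> \<omega>)"
  have L: "0 \<le> L" using Psi_nonneg[of k \<theta> \<omega>] by (simp add: L_def)
  have four: "(4::real) ^ k = 2 ^ k * 2 ^ k" by (simp flip: power_mult_distrib)
  have "\<bar>dev m u v \<omega>\<bar> \<le> 160 * 2 ^ k * (\<theta> + L / \<theta>) + 3 * 2 ^ k"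
    if u: "0 \<le> u" "u \<le> 1" and v: "0 \<le> v" "v \<le> 1" for u v
  proof -
    have x: "0 \<le> real m / 4 ^ k" "real m / 4 ^ k \<le> 1"
      using of_nat_mono[OF m, where 'a = real] by simp_all
    obtain a a' where a: "a \<le> 2 ^ k" "a' \<le> 2 ^ k"
      "real a / 2 ^ k \<le> real m / 4 ^ k" "real m / 4 ^ k \<le> real a' / 2 ^ k"
      "real m / 4 ^ k - real a / 2 ^ k \<le> 1 / 2 ^ k" "real a' / 2 ^ k - real m / 4 ^ k \<le> 1 / 2 ^ k"
      using dyadic_bracket[OF x] by metis
    obtain b b' where b: "b \<le> 2 ^ k" "b' \<le> 2 ^ k" "real b / 2 ^ k \<le> u" "u \<le> real b' / 2 ^ k"
      "u - real b / 2 ^ k \<le> 1 / 2 ^ k" "real b' / 2 ^ k - u \<le> 1 / 2 ^ k"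
      using dyadic_bracket[OF u] by metis
    obtain c c' where c: "c \<le> 2 ^ k" "c' \<le> 2 ^ k" "real c / 2 ^ k \<le> v" "v \<le> real c' / 2 ^ k"
      "v - real c / 2 ^ k \<le> 1 / 2 ^ k" "real c' / 2 ^ k - v \<le> 1 / 2 ^ k"
      using dyadic_bracket[OF v] by metis
    have G: "\<bar>dev (a * 2 ^ k) (real b / 2 ^ k) (real c / 2 ^ k) \<omega>\<bar> \<le> 160 * 2 ^ k * (\<theta> + L / \<theta>)"
      if "a \<le> 2 ^ k" "b \<le> 2 ^ k" "c \<le> 2 ^ k" for a b c
      using grid_le_Psi[OF \<theta>, of "(a, b, c)" k \<omega>] that by (simp add: cells_def grid_def L_def mult_2)
    have mb: "real (a * 2 ^ k) \<le> real m" "real m \<le> real (a' * 2 ^ k)"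
      "real m - real (a * 2 ^ k) \<le> 2 ^ k" "real (a' * 2 ^ k) - real m \<le> 2 ^ k"
      using a(3-6)[THEN mult_left_mono, of "4 ^ k"] unfolding four
      by (simp_all add: right_diff_distrib mult.commute)
    have M4: "real m \<le> 4 ^ k"
      using m by (metis of_nat_le_iff of_nat_numeral of_nat_power)
    then have M4': "real (a * 2 ^ k) \<le> 4 ^ k"
      using mb(1) by linarith
    have prod: "x * d \<le> 2 * 2 ^ k" if "0 \<le> x" "x \<le> 4 ^ k" "0 \<le> d" "d \<le> 2 / 2 ^ k" for x d :: real
    proof -
      have "x * d \<le> 4 ^ k * (2 / 2 ^ k)" using that by (intro mult_mono) auto
      then show ?thesis unfolding four by simp
    qed
    have "dev m u v \<omega> \<le> dev (a' * 2 ^ k) (real b' / 2 ^ k) (real c' / 2 ^ k) \<omega> +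
        (real (a' * 2 ^ k) - real m) + real m * ((real b' / 2 ^ k - u) + (real c' / 2 ^ k - v))"
      using mb(2) b(4) c(4) by (intro dev_mono_approx) (simp_all only: of_nat_le_iff)
    also have "\<dots> \<le> 160 * 2 ^ k * (\<theta> + L / \<theta>) + 2 ^ k + 2 * 2 ^ k"
      using G[OF a(2) b(2) c(2)] b c by (intro add_mono mb(4) prod M4) auto
    finally have up: "dev m u v \<omega> \<le> 160 * 2 ^ k * (\<theta> + L / \<theta>) + 3 * 2 ^ k" by simp
    have "dev (a * 2 ^ k) (real b / 2 ^ k) (real c / 2 ^ k) \<omega> \<le> dev m u v \<omega> +
        (real m - real (a * 2 ^ k)) + real (a * 2 ^ k) * ((u - real b / 2 ^ k) + (v - real c / 2 ^ k))"
      using mb(1) b(3) c(3) by (intro dev_mono_approx) (simp_all only: of_nat_le_iff)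
    also have "\<dots> \<le> dev m u v \<omega> + 2 ^ k + 2 * 2 ^ k"
      using b c by (intro add_mono mb(3) prod M4' order_refl) auto
    finally have "- (160 * 2 ^ k * (\<theta> + L / \<theta>) + 3 * 2 ^ k) \<le> dev m u v \<omega>"
      using G[OF a(1) b(1) c(1)] by simp
    with up show ?thesis by simp
  qed
  then have unit: "\<bar>dev m u v \<omega>\<bar> \<le> 160 * 2 ^ k * (\<theta> + L / \<theta>) + 3 * 2 ^ k"
    if "u \<le> 1" "v \<le> 1" for u v
    using that dev_eq_0[of u v m \<omega>] \<theta> L by (cases "u < 0 \<or> v < 0") auto
  have "\<bar>dev m u v \<omega>\<bar> \<le> 160 * 2 ^ k * (\<theta> + L / \<theta>) + 3 * 2 ^ k * 1"
    using unit[of "min u 1" "min v 1"] by (simp add: dev_min_1)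
  also have "\<dots> \<le> 160 * 2 ^ k * (\<theta> + L / \<theta>) + 3 * 2 ^ k * (\<theta> + L / \<theta>)"
    using \<theta> L by (intro add_left_mono mult_left_mono) (auto simp: add_increasing2)
  also have "\<dots> = 163 * 2 ^ k * (\<theta> + L / \<theta>)" by simp
  finally show ?thesis by (simp add: L_def)
qed

end

subsection \<open>The rate of the empirical process\<close>

text \<open>Take the least \<open>k\<close> with \<open>n \<le> 4 ^ k\<close>; minimality gives
  \<open>4 ^ (k - 1) \<le> n\<close>, so \<open>2 ^ k\<close> is of order \<open>sqrt n\<close>. The
  threshold 256 is \<open>4 ^ 4\<close>: it forces \<open>5 \<le> k\<close>, and from there on
  \<open>exp k \<le> 4 ^ (k - 1)\<close>, starting with \<open>exp 5 \<le> 3 ^ 5\<close>; hence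
  \<open>k \<le> ln n\<close>.\<close>

lemma dyadic_level:
  assumes n: "256 < n"
  obtains k :: nat where "5 \<le> k" "n \<le> 4 ^ k" "2 ^ k \<le> 2 * sqrt (real n)" "ln (real k) \<le> ln (ln (real n))"
proof
  define k where "k = (LEAST k. n \<le> 4 ^ k)"
  have "n < 4 ^ n" by (rule less_exp[THEN less_le_trans]) (simp add: power_mono)
  then show le: "n \<le> 4 ^ k" unfolding k_def by (intro LeastI) (rule less_imp_le)
  show k5: "5 \<le> k"
  proof (rule ccontr)
    assume "\<not> 5 \<le> k"
    then have "(4::nat) ^ k \<le> 4 ^ 4" by (intro power_increasing) auto
    with le n show False by simp
  qed
  then have "\<not> n \<le> 4 ^ (k - 1)" unfolding k_def by (intro not_less_Least) simp
  then have "4 ^ (k - 1) \<le> n" by simp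
  then have low: "(4::real) ^ (k - 1) \<le> real n"
    by (metis of_nat_le_iff of_nat_numeral of_nat_power)
  have "(2::real) ^ (k - 1) = sqrt (4 ^ (k - 1))"
    by (rule real_sqrt_unique[symmetric]) (simp_all add: power2_eq_square flip: power_mult_distrib)
  also have "\<dots> \<le> sqrt (real n)" using low by simp
  finally show "2 ^ k \<le> 2 * sqrt (real n)"
    using k5 by (cases k) simp_all
  have exp3: "exp (real (j + 5)) \<le> 4 ^ (j + 4)" for j
  proof (induction j)
    case 0
    have "exp (real 5) = exp 1 ^ 5" by (simp flip: exp_of_nat_mult)
    also have "\<dots> \<le> 3 ^ 5" by (intro power_mono exp_le) auto
    finally show ?case by simp
  next
    case (Suc j)
    have "exp (real (Suc j + 5)) = exp 1 * exp (real (j + 5))" by (simp flip: exp_add)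
    also have "\<dots> \<le> 4 * 4 ^ (j + 4)" using exp_le by (intro mult_mono Suc) auto
    finally show ?case by (simp add: power_add)
  qed
  have "exp (real k) \<le> 4 ^ (k - 1)" using exp3[of "k - 5"] k5 by simp
  also note low
  finally have "real k \<le> ln (real n)" using n by (simp add: ln_ge_iff)
  then show "ln (real k) \<le> ln (ln (real n))" using k5 by simp
qed

lemma one_le_ln_ln:
  assumes "256 < n"
  shows "1 \<le> ln (ln (real n))"
proof -
  obtain k where k: "5 \<le> k" "ln (real k) \<le> ln (ln (real n))"
    using dyadic_level[OF assms] by metis
  have "1 \<le> ln (real k)" using exp_le k(1) by (simp add: ln_ge_iff)
  with k(2) show ?thesis by simp
qed

section \<open>Almost sure and mean bounds of order \<open>sqrt (n log log n)\<close>\<close>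

context uniform_pairs
begin

text \<open>The choice of \<open>\<theta>\<close> at level \<open>k\<close>: it balances
  \<open>\<theta>\<close> against \<open>ln (1 + Psi) / \<theta>\<close> when \<open>Psi\<close>
  grows polynomially in \<open>k\<close>. By the default \<open>ln 0 = 0\<close>,
  \<open>lvl 0\<close> is 0.\<close>

definition lvl :: "nat \<Rightarrow> real" where
  "lvl k = sqrt (ln (real k))"

lemma lvl_nonneg: "0 \<le> lvl k"
  by (cases "k = 0") (simp_all add: lvl_def)

lemma lvl_ge_1: "5 \<le> k \<Longrightarrow> 1 \<le> lvl k"
  using exp_le by (simp add: lvl_def ln_ge_iff)

lemma Psi_lvl_expectation:
  "integrable M (Psi k (lvl k))" "expectation (Psi k (lvl k)) \<le> 2"
proof -
  have "(lvl k)\<^sup>2 \<le> 3 * 2 ^ k"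
  proof (cases "k = 0")
    case False
    then have "(lvl k)\<^sup>2 = ln (real k)" by (simp add: lvl_def)
    also have "\<dots> \<le> real k" using False by (intro less_imp_le ln_less_self) simp
    also have "\<dots> \<le> 2 ^ k" using less_exp[of k] by (metis less_imp_le of_nat_le_iff of_nat_numeral of_nat_power)
    also have "\<dots> \<le> 3 * 2 ^ k" by simp
    finally show ?thesis .
  qed (simp add: lvl_def)
  from Psi_expectation[OF lvl_nonneg this]
  show "integrable M (Psi k (lvl k))" "expectation (Psi k (lvl k)) \<le> 2" .
qed

text \<open>Markov's inequality leaves probabilities of at most \<open>2 / (k + 1)\<^sup>2\<close>,
  which are summable. One event per \<open>k\<close> is enough, because \<open>Psi k\<close>
  controls all sample sizes up to \<open>4 ^ k\<close> at once.\<close>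

lemma AE_Psi_le: "AE \<omega> in M. \<forall>\<^sub>F k in sequentially. Psi k (lvl k) \<omega> \<le> (real k + 1)\<^sup>2"
proof -
  define A where "A k = {\<omega>\<in>space M. (real k + 1)\<^sup>2 \<le> Psi k (lvl k) \<omega>}" for k
  have [measurable]: "Psi k (lvl k) \<in> borel_measurable M" for k
    using Psi_lvl_expectation(1) by (rule borel_measurable_integrable)
  have A: "A k \<in> sets M" for k unfolding A_def by measurable
  have le: "prob (A k) \<le> 2 * (1 / (real k + 1)\<^sup>2)" for k
  proof -
    have "prob (A k) \<le> expectation (Psi k (lvl k)) / (real k + 1)\<^sup>2"
      unfolding A_def
      by (rule integral_Markov_inequality_measure[where A = "space M"])
         (auto intro: Psi_lvl_expectation Psi_nonneg)
    also have "\<dots> \<le> 2 / (real k + 1)\<^sup>2"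
      by (intro divide_right_mono Psi_lvl_expectation) auto
    finally show ?thesis by simp
  qed
  have "summable (\<lambda>k. inverse (real (Suc k) ^ 2))"
    using inverse_power_summable[of 2, where 'a = real] by (subst summable_Suc_iff) simp
  then have "summable (\<lambda>k. 2 * (1 / (real k + 1)\<^sup>2))"
    by (intro summable_mult) (simp add: inverse_eq_divide add.commute)
  then have sum: "summable (\<lambda>k. prob (A k))"
    by (rule summable_comparison_test'[of _ 0]) (use le in auto)
  have "AE \<omega> in M. \<forall>\<^sub>F k in sequentially. \<omega> \<in> space M - A k"
    by (rule borel_cantelli_AE1[OF A _ sum]) (simp add: less_top[symmetric])
  then show ?thesis
    by (rule AE_mp) (auto simp: A_def intro!: AE_I2 elim: eventually_mono)
qed

text \<open>The constant is \<open>163 * 2 * 4\<close>: 2 from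
  \<open>2 ^ k \<le> 2 * sqrt n\<close>, and 4 from \<open>lvl k\<close> plus a logarithmic term of
  at most \<open>3 * lvl k\<close>.\<close>

lemma AE_dev_bound:
  "AE \<omega> in M. \<forall>\<^sub>F n in sequentially. \<forall>u v. \<bar>dev n u v \<omega>\<bar> \<le> 1304 * (sqrt (real n) * sqrt (ln (ln (real n))))"
  using AE_Psi_le
proof (rule AE_mp, intro AE_I2 impI)
  fix \<omega> assume "\<forall>\<^sub>F k in sequentially. Psi k (lvl k) \<omega> \<le> (real k + 1)\<^sup>2"
  then obtain K where K: "\<And>k. K \<le> k \<Longrightarrow> Psi k (lvl k) \<omega> \<le> (real k + 1)\<^sup>2"
    by (auto simp: eventually_sequentially)
  show "\<forall>\<^sub>F n in sequentially. \<forall>u v. \<bar>dev n u v \<omega>\<bar> \<le> 1304 * (sqrt (real n) * sqrt (ln (ln (real n))))"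
  proof (rule eventually_sequentiallyI, intro allI)
    fix n u v assume "max 257 (Suc (4 ^ K)) \<le> n"
    then have n: "256 < n" "4 ^ K < n" by auto
    obtain k where k: "5 \<le> k" "n \<le> 4 ^ k" "2 ^ k \<le> 2 * sqrt (real n)" "ln (real k) \<le> ln (ln (real n))"
      using dyadic_level[OF n(1)] .
    have "(4::nat) ^ K < 4 ^ k" using n k by linarith
    then have "K \<le> k" by simp
    from K[OF this] have "1 + Psi k (lvl k) \<omega> \<le> 1 + (real k + 1)\<^sup>2" by simp
    \<comment> \<open>A pure power of \<open>k\<close> makes the logarithm an exact multiple of
      \<open>(lvl k)\<^sup>2\<close>; \<open>5 \<le> k\<close> is enough for this.\<close>
    also have "\<dots> \<le> real k ^ 3"
    proof -
      have "5 * (real k * real k) \<le> real k * (real k * real k)" "5 * real k \<le> real k * real k"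
        using k(1) by (intro mult_right_mono; simp)+
      moreover have "1 + (real k + 1)\<^sup>2 = 2 + real k * real k + 2 * real k"
        by (simp add: power2_eq_square algebra_simps)
      moreover have "real k ^ 3 = real k * (real k * real k)" by (simp add: power3_eq_cube)
      ultimately show ?thesis using k(1) by linarith
    qed
    finally have "ln (1 + Psi k (lvl k) \<omega>) \<le> ln (real k ^ 3)"
      using Psi_nonneg[of k "lvl k" \<omega>] by (intro ln_mono) auto
    also have "\<dots> = 3 * (lvl k)\<^sup>2" using k(1) by (simp add: ln_realpow lvl_def)
    finally have L: "ln (1 + Psi k (lvl k) \<omega>) / lvl k \<le> 3 * lvl k"
      using lvl_ge_1[OF k(1)] by (simp add: divide_le_eq power2_eq_square mult.assoc)
    have "\<bar>dev n u v \<omega>\<bar> \<le> 163 * 2 ^ k * (lvl k + ln (1 + Psi k (lvl k) \<omega>) / lvl k)"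
      by (rule dev_le_Psi[OF lvl_ge_1[OF k(1)] k(2)])
    also have "\<dots> \<le> 163 * (2 * sqrt (real n)) * (4 * sqrt (ln (ln (real n))))"
    proof (intro mult_mono)
      have "lvl k \<le> sqrt (ln (ln (real n)))" using k(4) by (simp add: lvl_def)
      with L show "lvl k + ln (1 + Psi k (lvl k) \<omega>) / lvl k \<le> 4 * sqrt (ln (ln (real n)))" by simp
    qed (use k(3) lvl_nonneg[of k] Psi_nonneg[of k "lvl k" \<omega>] in auto)
    finally show "\<bar>dev n u v \<omega>\<bar> \<le> 1304 * (sqrt (real n) * sqrt (ln (ln (real n))))" by simp
  qed
qed

text \<open>An integrable majorant \<open>W\<close> independent of \<open>u\<close> and
  \<open>v\<close> avoids the measurability of the supremum. The constant is
  \<open>163 * 2 * 3\<close>, as \<open>lvl k + 2 / lvl k\<close> is at most three times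
  \<open>sqrt (ln (ln n))\<close>.\<close>

lemma dev_dominated:
  assumes n: "256 < n"
  obtains W where "integrable M W" "\<And>u v \<omega>. \<bar>dev n u v \<omega>\<bar> \<le> W \<omega>"
    "expectation W \<le> 978 * (sqrt (real n) * sqrt (ln (ln (real n))))"
proof -
  obtain k where k: "5 \<le> k" "n \<le> 4 ^ k" "2 ^ k \<le> 2 * sqrt (real n)" "ln (real k) \<le> ln (ln (real n))"
    using dyadic_level[OF n] .
  define W where "W \<omega> = 163 * 2 ^ k * (lvl k + Psi k (lvl k) \<omega> / lvl k)" for \<omega>
  note 1 = lvl_ge_1[OF k(1)]
  show thesis
  proof
    show "integrable M W"
      unfolding W_def[abs_def] using Psi_lvl_expectation(1) by simp
    show "\<bar>dev n u v \<omega>\<bar> \<le> W \<omega>" for u v \<omega>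
    proof -
      have "ln (1 + Psi k (lvl k) \<omega>) \<le> Psi k (lvl k) \<omega>"
        by (rule ln_add_one_self_le_self[OF Psi_nonneg])
      then have "163 * 2 ^ k * (lvl k + ln (1 + Psi k (lvl k) \<omega>) / lvl k) \<le> W \<omega>"
        unfolding W_def using 1 by (intro mult_left_mono add_left_mono divide_right_mono) auto
      with dev_le_Psi[OF 1 k(2), of u v \<omega>] show ?thesis by linarith
    qed
    have "expectation W = 163 * 2 ^ k * (lvl k + expectation (Psi k (lvl k)) / lvl k)"
      unfolding W_def[abs_def] using Psi_lvl_expectation(1) by (simp add: prob_space)
    also have "\<dots> \<le> 163 * (2 * sqrt (real n)) * (3 * sqrt (ln (ln (real n))))"
    proof (intro mult_mono)
      have "expectation (Psi k (lvl k)) / lvl k \<le> 2 / 1"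
        using Psi_lvl_expectation(2)[of k] 1 by (intro frac_le) auto
      moreover have "lvl k \<le> sqrt (ln (ln (real n)))" using k(4) by (simp add: lvl_def)
      ultimately show "lvl k + expectation (Psi k (lvl k)) / lvl k \<le> 3 * sqrt (ln (ln (real n)))"
        using 1 by simp
    qed (use k(3) lvl_nonneg[of k] Psi_nonneg[of k "lvl k"] in auto)
    finally show "expectation W \<le> 978 * (sqrt (real n) * sqrt (ln (ln (real n))))" by simp
  qed
qed

end

subsection \<open>Pseudo-observations\<close>

text \<open>A pseudo-observation is a rank over \<open>n + 1\<close>, and the rank lies between 1,
  since \<open>i\<close> counts itself, and \<open>n\<close>. Replacing \<open>n + 1\<close> by
  \<open>n\<close> changes it by at most \<open>1 / n\<close>.\<close>

lemma pseudo_obs_bounds: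
  assumes n: "1 \<le> n" and i: "i \<in> {1..n}"
  shows "0 < pseudo_obs x n i" "pseudo_obs x n i < 1"
    and "pseudo_obs x n i \<le> emp_cdf x n (x i)"
    and "emp_cdf x n (x i) - 1 / real n \<le> pseudo_obs x n i"
proof -
  let ?A = "{l \<in> {1..n}. x l \<le> x i}"
  have "i \<in> ?A" using i by auto
  then have "0 < card ?A" by (auto simp: card_gt_0_iff)
  moreover have "card ?A \<le> card {1..n}" by (intro card_mono) auto
  ultimately have c: "1 \<le> real (card ?A)" "real (card ?A) \<le> real n" by auto
  have e: "emp_cdf x n (x i) = real (card ?A) / real n" and
    p: "pseudo_obs x n i = real (card ?A) / (real n + 1)"
    using n by (simp_all add: pseudo_obs_def emp_cdf_def)
  show "0 < pseudo_obs x n i" "pseudo_obs x n i < 1"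
    using c by (simp_all add: p)
  show "pseudo_obs x n i \<le> emp_cdf x n (x i)"
    unfolding p e using n by (intro divide_left_mono) auto
  have "real (card ?A) * real n + real (card ?A) \<le> real (card ?A) * real n + real n + 1"
    using c by linarith
  then show "emp_cdf x n (x i) - 1 / real n \<le> pseudo_obs x n i"
    unfolding p e using n by (simp add: field_simps)
qed

text \<open>Ties among the \<open>x l\<close> and flat pieces of \<open>F\<close> need no almost-sure argument: \<open>x l \<le> x i\<close> implies
  \<open>F (x l) \<le> F (x i)\<close>, and \<open>F (x l) < F (x i)\<close> implies \<open>x l \<le> x i\<close>.\<close>

lemma pseudo_obs_near_cdf:
  assumes n: "1 \<le> n" and i: "i \<in> {1..n}" and F: "mono F"
    and unit: "F (x i) \<in> {0..1}"
    and unif: "\<And>t. t \<in> {0..1} \<Longrightarrow> \<bar>real (card {l\<in>{1..n}. F (x l) \<le> t}) / real n - t\<bar> \<le> \<delta>"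
  shows "pseudo_obs x n i \<le> F (x i) + \<delta>"
    and "F (x i) - \<delta> - 1 / real n \<le> pseudo_obs x n i"
proof -
  have "emp_cdf x n (x i) \<le> real (card {l\<in>{1..n}. F (x l) \<le> F (x i)}) / real n"
    unfolding emp_cdf_def using monoD[OF F]
    by (intro divide_right_mono of_nat_mono card_mono) auto
  also have "\<dots> \<le> F (x i) + \<delta>" using unif[OF unit] by simp
  finally show "pseudo_obs x n i \<le> F (x i) + \<delta>"
    using pseudo_obs_bounds(3)[OF n i, of x] by simp
  have "F (x i) - \<delta> \<le> emp_cdf x n (x i)"
  \<comment> \<open>The level is lowered by \<open>e\<close> to obtain a strict inequality between
    values of \<open>F\<close>, which alone orders the arguments. If \<open>e\<close> reaches
    \<open>F (x i)\<close>, the lowered level might leave the unit interval, but then the claim is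
    trivial.\<close>
  proof (rule field_le_epsilon)
    fix e :: real assume e: "0 < e"
    have nonneg: "0 \<le> emp_cdf x n (x i)" by (simp add: emp_cdf_def)
    have "0 \<le> \<delta>" using order_trans[OF abs_ge_zero unif[of 0]] by simp
    show "F (x i) - \<delta> \<le> emp_cdf x n (x i) + e"
    proof (cases "F (x i) \<le> e")
      case True
      with nonneg \<open>0 \<le> \<delta>\<close> show ?thesis by simp
    next
      case False
      have "x l \<le> x i" if "F (x l) \<le> F (x i) - e" for l
        using that e monoD[OF F, of "x i" "x l"] by (cases "x l \<le> x i") auto
      then have "real (card {l\<in>{1..n}. F (x l) \<le> F (x i) - e}) / real n \<le> emp_cdf x n (x i)"
        unfolding emp_cdf_def by (intro divide_right_mono of_nat_mono card_mono) auto
      moreover have "F (x i) - e - \<delta> \<le> real (card {l\<in>{1..n}. F (x l) \<le> F (x i) - e}) / real n"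
        using unif[of "F (x i) - e"] False unit e by simp
      ultimately show ?thesis by simp
    qed
  qed
  then show "F (x i) - \<delta> - 1 / real n \<le> pseudo_obs x n i"
    using pseudo_obs_bounds(4)[OF n i, of x] by simp
qed

section \<open>Empirical copulas of pseudo-observations\<close>

context uniform_pairs
begin

text \<open>Moving each point by at most \<open>?e\<close> is compensated by moving the corner by
  \<open>?e\<close>. As \<open>n * ?e = E + 1\<close>, the two coordinates cost
  \<open>2 * E + 2\<close>, and the process at the shifted corner costs another
  \<open>E\<close>.\<close>

lemma count_near_p:
  assumes n: "1 \<le> n" and E: "\<And>u v. \<bar>dev n u v \<omega>\<bar> \<le> E"
    and a: "\<And>i. i \<in> {1..n} \<Longrightarrow> \<bar>a i - U i \<omega>\<bar> \<le> (E + 1) / real n"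
    and b: "\<And>i. i \<in> {1..n} \<Longrightarrow> \<bar>b i - V i \<omega>\<bar> \<le> (E + 1) / real n"
  shows "\<bar>(\<Sum>i=1..n. of_bool (a i \<le> s) * of_bool (b i \<le> t)) - real n * p s t\<bar> \<le> 3 * E + 2"
proof -
  let ?e = "(E + 1) / real n"
  let ?N = "\<Sum>i=1..n. of_bool (a i \<le> s) * of_bool (b i \<le> t) :: real"
  have e: "0 \<le> ?e" using E[of 0 0] by simp
  have ne: "real n * ?e = E + 1" using n by simp
  have "?N \<le> (\<Sum>i=1..n. quadrant (s + ?e) (t + ?e) i \<omega>)"
  proof (rule sum_mono)
    fix i assume "i \<in> {1..n}"
    with a[of i] b[of i] show "of_bool (a i \<le> s) * of_bool (b i \<le> t) \<le> quadrant (s + ?e) (t + ?e) i \<omega>"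
      by (auto simp: quadrant_def)
  qed
  also have "\<dots> = dev n (s + ?e) (t + ?e) \<omega> + real n * p (s + ?e) (t + ?e)"
    by (simp add: dev_def sum_subtractf)
  also have "\<dots> \<le> E + real n * (p s t + ?e + ?e)"
    using E[of "s + ?e" "t + ?e"] p_lipschitz[of s "s + ?e" t "t + ?e"] e
    by (intro add_mono mult_left_mono) auto
  also have "\<dots> = real n * p s t + (3 * E + 2)"
    unfolding distrib_left ne by simp
  finally have up: "?N \<le> real n * p s t + (3 * E + 2)" .
  have "real n * p s t \<le> real n * (p (s - ?e) (t - ?e) + ?e + ?e)"
    using p_lipschitz[of "s - ?e" s "t - ?e" t] e by (intro mult_left_mono) auto
  also have "\<dots> = real n * p (s - ?e) (t - ?e) + 2 * E + 2"
    unfolding distrib_left ne by simp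
  also have "\<dots> = (\<Sum>i=1..n. quadrant (s - ?e) (t - ?e) i \<omega>) - dev n (s - ?e) (t - ?e) \<omega> + 2 * E + 2"
    by (simp add: dev_def sum_subtractf)
  also have "\<dots> \<le> ?N + E + 2 * E + 2"
  proof -
    have "(\<Sum>i=1..n. quadrant (s - ?e) (t - ?e) i \<omega>) \<le> ?N"
    proof (rule sum_mono)
      fix i assume "i \<in> {1..n}"
      with a[of i] b[of i] show "quadrant (s - ?e) (t - ?e) i \<omega> \<le> of_bool (a i \<le> s) * of_bool (b i \<le> t)"
        by (auto simp: quadrant_def)
    qed
    with E[of "s - ?e" "t - ?e"] show ?thesis by simp
  qed
  finally show ?thesis using up by simp
qed

text \<open>The marginal empirical processes are \<open>dev\<close> with the other argument equal to
  1, so the same \<open>E\<close> also bounds the distance of the pseudo-observations from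
  \<open>U\<close> and \<open>V\<close>.\<close>

lemma count_pseudo_obs:
  assumes n: "1 \<le> n" and E: "\<And>u v. \<bar>dev n u v \<omega>\<bar> \<le> E"
    and F: "mono F" "\<And>i. U i \<omega> = F (x i)" and G: "mono G" "\<And>i. V i \<omega> = G (y i)"
  shows "\<bar>(\<Sum>i=1..n. of_bool (pseudo_obs x n i \<le> s) * of_bool (pseudo_obs y n i \<le> t)) - real n * p s t\<bar>
    \<le> 3 * E + 2"
proof (rule count_near_p[OF n E])
  have cnt: "real (card {l\<in>{1..n}. P l}) = (\<Sum>l=1..n. of_bool (P l))" for P
    by (simp add: sum_of_bool_eq Int_def)
  fix i assume i: "i \<in> {1..n}"
  have "\<bar>real (card {l\<in>{1..n}. F (x l) \<le> r}) / real n - r\<bar> \<le> E / real n" if "r \<in> {0..1}" for r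
  proof -
    have "real (card {l\<in>{1..n}. F (x l) \<le> r}) - real n * r = dev n r 1 \<omega>"
      unfolding cnt dev_def quadrant_def sum_subtractf F(2)[symmetric] using that V_unit p_margin by simp
    then have "real (card {l\<in>{1..n}. F (x l) \<le> r}) / real n - r = dev n r 1 \<omega> / real n"
      using n by (simp add: field_simps)
    then show ?thesis using E[of r 1] by (simp add: divide_right_mono)
  qed
  from pseudo_obs_near_cdf[OF n i F(1) _ this] U_unit[of i \<omega>]
  have "pseudo_obs x n i \<le> F (x i) + E / real n" "F (x i) - E / real n - 1 / real n \<le> pseudo_obs x n i"
    by (auto simp: F(2))
  moreover have "0 < 1 / real n" using n by simp
  ultimately show "\<bar>pseudo_obs x n i - U i \<omega>\<bar> \<le> (E + 1) / real n"
    unfolding F(2) add_divide_distrib by linarith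
  have "\<bar>real (card {l\<in>{1..n}. G (y l) \<le> r}) / real n - r\<bar> \<le> E / real n" if "r \<in> {0..1}" for r
  proof -
    have "real (card {l\<in>{1..n}. G (y l) \<le> r}) - real n * r = dev n 1 r \<omega>"
      unfolding cnt dev_def quadrant_def sum_subtractf G(2)[symmetric] using that U_unit p_margin by simp
    then have "real (card {l\<in>{1..n}. G (y l) \<le> r}) / real n - r = dev n 1 r \<omega> / real n"
      using n by (simp add: field_simps)
    then show ?thesis using E[of 1 r] by (simp add: divide_right_mono)
  qed
  from pseudo_obs_near_cdf[OF n i G(1) _ this] V_unit[of i \<omega>]
  have "pseudo_obs y n i \<le> G (y i) + E / real n" "G (y i) - E / real n - 1 / real n \<le> pseudo_obs y n i"
    by (auto simp: G(2))
  moreover have "0 < 1 / real n" using n by simp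
  ultimately show "\<bar>pseudo_obs y n i - V i \<omega>\<bar> \<le> (E + 1) / real n"
    unfolding G(2) add_divide_distrib by linarith
qed

end

subsection \<open>Kernel estimators as mixtures of empirical copulas\<close>

lemma kernel_integrable:
  assumes "is_kernel k"
  shows "integrable lebesgue k"
proof -
  obtain B where B: "\<And>s. \<bar>k s\<bar> \<le> B"
    using assms by (auto simp: is_kernel_def bounded_iff)
  have "integrable lebesgue (\<lambda>s. B * indicator {-1..1::real} s)"
    by (intro integrable_mult_right) (simp add: lmeasurable_cbox)
  then show ?thesis
  proof (rule Bochner_Integration.integrable_bound)
    show "k \<in> borel_measurable lebesgue" using assms by (simp add: is_kernel_def)
    show "AE s in lebesgue. norm (k s) \<le> norm (B * indicator {-1..1} s)"
    proof (rule AE_I2)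
      fix s
      show "norm (k s) \<le> norm (B * indicator {-1..1} s)"
      proof (cases "s \<in> {-1..1}")
        case True
        then show ?thesis using B[of s] by auto
      next
        case False
        then have "k s = 0" using assms by (simp add: is_kernel_def)
        then show ?thesis by simp
      qed
    qed
  qed
qed

text \<open>Monotonicity gives one direction; for the other, uniqueness of the preimage excludes a
  flat piece of \<open>\<phi>\<close> at height \<open>w\<close>.\<close>

lemma inv_transformation_le_iff:
  assumes \<phi>: "is_transformation \<phi>" and w: "w \<in> {0<..<1}"
  shows "inv \<phi> w \<le> t \<longleftrightarrow> w \<le> \<phi> t"
proof -
  have mono: "mono \<phi>" and ex1: "\<exists>!x. \<phi> x = w"
    using assms by (auto simp: is_transformation_def)
  from ex1 have inv: "\<phi> (inv \<phi> w) = w" by (metis (mono_tags) f_inv_into_f rangeI)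
  show ?thesis
  proof
    assume "inv \<phi> w \<le> t"
    with monoD[OF mono this] inv show "w \<le> \<phi> t" by simp
  next
    assume le: "w \<le> \<phi> t"
    show "inv \<phi> w \<le> t"
    proof (rule ccontr)
      assume "\<not> inv \<phi> w \<le> t"
      with monoD[OF mono, of t "inv \<phi> w"] inv le have "\<phi> t = w" by simp
      with ex1 inv have "t = inv \<phi> w" by auto
      with \<open>\<not> inv \<phi> w \<le> t\<close> show False by simp
    qed
  qed
qed

lemma kernel_cdf_mixture:
  assumes k: "is_kernel k" and \<phi>: "is_transformation \<phi>" and w: "w \<in> {0<..<1}" and h: "0 < h"
  shows "kernel_cdf k ((a - inv \<phi> w) / h) = (LINT s|lebesgue. of_bool (w \<le> \<phi> (a - h * s)) * k s)"
    and "integrable lebesgue (\<lambda>s. of_bool (w \<le> \<phi> (a - h * s)) * k s)"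
proof -
  have iff: "s \<le> (a - inv \<phi> w) / h \<longleftrightarrow> w \<le> \<phi> (a - h * s)" for s
    using h by (simp add: le_divide_eq mult.commute algebra_simps flip: inv_transformation_le_iff[OF \<phi> w])
  have eq: "of_bool (w \<le> \<phi> (a - h * s)) * k s = indicator {..(a - inv \<phi> w) / h} s * k s" for s
    by (simp add: indicator_def iff)
  show "kernel_cdf k ((a - inv \<phi> w) / h) = (LINT s|lebesgue. of_bool (w \<le> \<phi> (a - h * s)) * k s)"
    by (simp add: kernel_cdf_def set_lebesgue_integral_def eq)
  show "integrable lebesgue (\<lambda>s. of_bool (w \<le> \<phi> (a - h * s)) * k s)"
    unfolding eq using integrable_mult_indicator[OF _ kernel_integrable[OF k], of "{..(a - inv \<phi> w) / h}"]
    by simp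
qed

text \<open>The weights \<open>c\<close> are arbitrary reals so that the lemma can be applied to one
  coordinate at a time. As \<open>k\<close> may change sign, the mixture has mass up to the integral
  of its absolute value.\<close>

lemma kernel_sum_le:
  assumes k: "is_kernel k" and \<phi>: "is_transformation \<phi>" and h: "0 < h"
    and w: "\<And>i. i \<in> I \<Longrightarrow> w i \<in> {0<..<1}"
    and B: "\<And>t. \<bar>\<Sum>i\<in>I. c i * of_bool (w i \<le> t)\<bar> \<le> B"
  shows "\<bar>\<Sum>i\<in>I. c i * kernel_cdf k ((a - inv \<phi> (w i)) / h)\<bar> \<le> B * (LINT s|lebesgue. \<bar>k s\<bar>)"
proof -
  let ?S = "\<lambda>s. \<Sum>i\<in>I. c i * of_bool (w i \<le> \<phi> (a - h * s))"
  note mix = kernel_cdf_mixture[OF k \<phi> w h]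
  have fin: "(\<Sum>i\<in>I. c i * kernel_cdf k ((a - inv \<phi> (w i)) / h))
      = (\<Sum>i\<in>I. (LINT s|lebesgue. c i * (of_bool (w i \<le> \<phi> (a - h * s)) * k s)))"
    by (intro sum.cong refl) (simp add: mix(1))
  also have "\<dots> = (LINT s|lebesgue. (\<Sum>i\<in>I. c i * (of_bool (w i \<le> \<phi> (a - h * s)) * k s)))"
    by (rule Bochner_Integration.integral_sum[symmetric]) (intro integrable_mult_right mix(2))
  also have "\<dots> = (LINT s|lebesgue. ?S s * k s)"
    by (simp add: sum_distrib_right mult.assoc)
  finally have eq: "(\<Sum>i\<in>I. c i * kernel_cdf k ((a - inv \<phi> (w i)) / h)) = (LINT s|lebesgue. ?S s * k s)" .
  have "integrable lebesgue (\<lambda>s. \<Sum>i\<in>I. c i * (of_bool (w i \<le> \<phi> (a - h * s)) * k s))"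
    by (intro Bochner_Integration.integrable_sum integrable_mult_right mix(2))
  then have int: "integrable lebesgue (\<lambda>s. ?S s * k s)"
    by (simp add: sum_distrib_right mult.assoc)
  have "\<bar>LINT s|lebesgue. ?S s * k s\<bar> \<le> (LINT s|lebesgue. \<bar>?S s * k s\<bar>)"
    by (rule integral_abs_bound)
  also have "\<dots> \<le> (LINT s|lebesgue. B * \<bar>k s\<bar>)"
    by (intro integral_mono integrable_abs int integrable_mult_right kernel_integrable[OF k])
       (auto simp: abs_mult intro!: mult_right_mono B)
  finally show ?thesis by (simp add: eq)
qed

text \<open>Two applications of \<open>kernel_sum_le\<close>: first the indicators in
  \<open>w\<close> are part of the weights, then the kernel values in \<open>z\<close> are.\<close>

lemma kernel_product_sum_le:
  assumes k: "is_kernel k" and \<phi>: "is_transformation \<phi>" and h: "0 < h"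
    and w: "\<And>i. i \<in> I \<Longrightarrow> w i \<in> {0<..<1}" and z: "\<And>i. i \<in> I \<Longrightarrow> z i \<in> {0<..<1}"
    and B: "\<And>s t. \<bar>\<Sum>i\<in>I. c i * (of_bool (w i \<le> s) * of_bool (z i \<le> t))\<bar> \<le> B"
  shows "\<bar>\<Sum>i\<in>I. c i * (kernel_cdf k ((a - inv \<phi> (w i)) / h) * kernel_cdf k ((b - inv \<phi> (z i)) / h))\<bar>
    \<le> B * (LINT s|lebesgue. \<bar>k s\<bar>)\<^sup>2"
proof -
  let ?K = "\<lambda>x. kernel_cdf k (x / h)"
  have "\<bar>\<Sum>i\<in>I. (c i * of_bool (w i \<le> s)) * ?K (b - inv \<phi> (z i))\<bar> \<le> B * (LINT s|lebesgue. \<bar>k s\<bar>)" for s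
    by (rule kernel_sum_le[OF k \<phi> h z]) (use B in \<open>simp_all add: mult.assoc\<close>)
  then have "\<bar>\<Sum>i\<in>I. (c i * ?K (b - inv \<phi> (z i))) * of_bool (w i \<le> s)\<bar> \<le> B * (LINT s|lebesgue. \<bar>k s\<bar>)" for s
    by (simp only: mult.assoc mult.left_commute mult.commute)
  from kernel_sum_le[OF k \<phi> h w this, of a] show ?thesis
    by (simp only: mult.assoc mult.left_commute mult.commute power2_eq_square)
qed

lemma copula_est_diff_le:
  assumes k: "is_kernel k" and \<phi>: "is_transformation \<phi>" and h: "0 < h" and n: "1 \<le> n"
    and B: "\<And>s t. \<bar>(\<Sum>i=1..n. of_bool (pseudo_obs x n i \<le> s) * of_bool (pseudo_obs y n i \<le> t))
      - (\<Sum>i=1..n. of_bool (pseudo_obs x' n i \<le> s) * of_bool (pseudo_obs y' n i \<le> t))\<bar> \<le> B"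
  shows "\<bar>copula_est k \<phi> x y n h u v - copula_est k \<phi> x' y' n h u v\<bar>
    \<le> B * (LINT s|lebesgue. \<bar>k s\<bar>)\<^sup>2 / real n"
proof -
  \<comment> \<open>The two samples are put side by side with weights 1 and -1, so that their
    difference becomes one weighted sum.\<close>
  define I where "I = {1..n} <+> {1..n}"
  define c :: "nat + nat \<Rightarrow> real" where "c = case_sum (\<lambda>_. 1) (\<lambda>_. - 1)"
  define w where "w = case_sum (pseudo_obs x n) (pseudo_obs x' n)"
  define z where "z = case_sum (pseudo_obs y n) (pseudo_obs y' n)"
  have sumI: "(\<Sum>i\<in>I. c i * f (w i) (z i))
      = (\<Sum>i=1..n. f (pseudo_obs x n i) (pseudo_obs y n i)) - (\<Sum>i=1..n. f (pseudo_obs x' n i) (pseudo_obs y' n i))"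
    for f :: "real \<Rightarrow> real \<Rightarrow> real"
    unfolding I_def by (subst sum.Plus) (simp_all add: c_def w_def z_def sum_negf)
  have unit: "w i \<in> {0<..<1}" "z i \<in> {0<..<1}" if "i \<in> I" for i
    using that pseudo_obs_bounds(1,2)[OF n] by (auto simp: I_def w_def z_def)
  have "\<bar>\<Sum>i\<in>I. c i * (kernel_cdf k ((inv \<phi> u - inv \<phi> (w i)) / h) * kernel_cdf k ((inv \<phi> v - inv \<phi> (z i)) / h))\<bar>
      \<le> B * (LINT s|lebesgue. \<bar>k s\<bar>)\<^sup>2"
    by (rule kernel_product_sum_le[OF k \<phi> h unit])
       (use B in \<open>auto simp: sumI[of "\<lambda>w z. of_bool (w \<le> s) * of_bool (z \<le> t)" for s t]\<close>)
  then show ?thesis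
    unfolding sumI[of "\<lambda>w z. kernel_cdf k ((inv \<phi> u - inv \<phi> w) / h) * kernel_cdf k ((inv \<phi> v - inv \<phi> z) / h)"]
    using n by (simp add: copula_est_def abs_divide divide_right_mono flip: diff_divide_distrib)
qed

lemma copula_est_bounded:
  assumes k: "is_kernel k" and \<phi>: "is_transformation \<phi>" and h: "0 < h" and n: "1 \<le> n"
  shows "\<bar>copula_est k \<phi> x y n h u v\<bar> \<le> (LINT s|lebesgue. \<bar>k s\<bar>)\<^sup>2"
proof -
  have "\<bar>\<Sum>i=1..n. 1 * (of_bool (pseudo_obs x n i \<le> s) * of_bool (pseudo_obs y n i \<le> t))\<bar> \<le> real n" for s t
  proof -
    let ?S = "\<Sum>i=1..n. 1 * (of_bool (pseudo_obs x n i \<le> s) * of_bool (pseudo_obs y n i \<le> t)) :: real"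
    have "?S \<le> (\<Sum>i=1..n. 1)" by (intro sum_mono) auto
    moreover have "0 \<le> ?S" by (intro sum_nonneg) auto
    ultimately show ?thesis by simp
  qed
  from kernel_product_sum_le[OF k \<phi> h _ _ this, of "inv \<phi> u" "inv \<phi> v"]
  have "\<bar>\<Sum>i=1..n. kernel_cdf k ((inv \<phi> u - inv \<phi> (pseudo_obs x n i)) / h)
      * kernel_cdf k ((inv \<phi> v - inv \<phi> (pseudo_obs y n i)) / h)\<bar> \<le> real n * (LINT s|lebesgue. \<bar>k s\<bar>)\<^sup>2"
    using pseudo_obs_bounds(1,2)[OF n] by simp
  then show ?thesis
    using n by (simp add: copula_est_def divide_le_eq mult.commute)
qed

subsection \<open>The almost sure rate of the copula estimator\<close>

text \<open>The probability integral transform. For \<open>u\<close> strictly between 0 and 1 the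
  sublevel set is a closed half-line ending at its supremum \<open>x0\<close>; beyond
  \<open>x0\<close> the distribution function exceeds \<open>u\<close>, so its value at
  \<open>x0\<close> is exactly \<open>u\<close>.\<close>

lemma (in real_distribution) measure_cdf_le:
  assumes cont: "continuous_on UNIV (cdf M)" and u: "u \<in> {0..1}"
  shows "measure M {x. cdf M x \<le> u} = u"
proof -
  have meas: "{x. cdf M x \<le> u} \<in> sets M" for u
    by (auto intro!: borel_closed closed_Collect_le cont continuous_intros)
  have interior: "measure M {x. cdf M x \<le> u} = u" if u: "0 < u" "u < 1" for u
  proof -
    let ?S = "{x. cdf M x \<le> u}"
    have "\<forall>\<^sub>F x in at_top. u < cdf M x"
      using order_tendstoD(1)[OF cdf_lim_at_top_prob u(2)] .
    then obtain b where b: "u < cdf M b" by (auto simp: eventually_at_top_linorder)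
    have "\<forall>\<^sub>F x in at_bot. cdf M x < u"
      using order_tendstoD(2)[OF cdf_lim_at_bot u(1)] .
    then obtain a where a: "cdf M a < u" by (auto simp: eventually_at_bot_linorder)
    have bdd: "x \<le> b" if "x \<in> ?S" for x
      using that b cdf_nondecreasing[of b x] by (cases "x \<le> b") auto
    then have bdd': "bdd_above ?S" by (auto simp: bdd_above_def)
    define x0 where "x0 = Sup ?S"
    have "closed ?S" by (intro closed_Collect_le cont continuous_intros)
    then have x0: "x0 \<in> ?S"
      unfolding x0_def
      using a bdd' by (intro closed_contains_Sup) (auto intro: less_imp_le)
    have S: "?S = {..x0}"
    proof (intro equalityI subsetI)
      fix x assume "x \<in> {..x0}"
      then show "x \<in> ?S" using x0 cdf_nondecreasing[of x "x0"] by auto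
    qed (use bdd' in \<open>auto simp: x0_def intro: cSup_upper\<close>)
    have "u \<le> cdf M (x0)"
    proof (rule tendsto_lowerbound)
      show "(cdf M \<longlongrightarrow> cdf M (x0)) (at_right (x0))"
        using cdf_is_right_cont[of "x0"] by (simp add: continuous_within)
      show "\<forall>\<^sub>F x in at_right (x0). u \<le> cdf M x"
      proof (rule eventually_at_right_less[THEN eventually_mono])
        fix x assume "x0 < x"
        with equalityD1[OF S] have "x \<notin> ?S" by auto
        then show "u \<le> cdf M x" by simp
      qed
    qed simp
    with x0 have "cdf M (x0) = u" by simp
    moreover have "measure M ?S = cdf M (x0)" unfolding S by (simp add: cdf_def)
    ultimately show ?thesis by simp
  qed
  consider "u = 0" | "u = 1" | "0 < u" "u < 1" using u by force
  then show ?thesis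
  proof cases
    case 1
    \<comment> \<open>At level 0 the sublevel set may be empty and have no last point, so it is
      compared with levels inside the open interval; the cap 1/2 keeps them there.\<close>
    have "measure M {x. cdf M x \<le> 0} \<le> 0 + e" if "0 < e" for e
    proof -
      have "measure M {x. cdf M x \<le> 0} \<le> measure M {x. cdf M x \<le> min e (1 / 2)}"
        by (intro finite_measure_mono meas) (use that in auto)
      also have "\<dots> = min e (1 / 2)" by (intro interior) (use that in auto)
      finally show ?thesis by simp
    qed
    then have "measure M {x. cdf M x \<le> 0} \<le> 0" by (rule field_le_epsilon)
    with 1 show ?thesis by (simp add: antisym)
  next
    case 2
    then have "{x. cdf M x \<le> u} = space M" using cdf_bounded_prob by auto
    then show ?thesis using prob_space 2 by simp
  next
    case 3
    then show ?thesis by (rule interior)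
  qed
qed

text \<open>Each pseudo-observation is a function of a rank, which is a measurable natural number,
  and every function on a discrete space is measurable. This covers \<open>inv \<phi>\<close> and
  \<open>kernel_cdf k\<close>.\<close>

lemma copula_est_measurable:
  assumes XY: "\<And>i. 1 \<le> i \<Longrightarrow> X i \<in> borel_measurable M" "\<And>i. 1 \<le> i \<Longrightarrow> Y i \<in> borel_measurable M"
  shows "(\<lambda>\<omega>. copula_est k \<phi> (\<lambda>i. X i \<omega>) (\<lambda>i. Y i \<omega>) n h u v) \<in> borel_measurable M"
proof -
  have obs: "(\<lambda>\<omega>. f (pseudo_obs (\<lambda>i. Z i \<omega>) n i)) \<in> borel_measurable M"
    if Z: "\<And>i. 1 \<le> i \<Longrightarrow> Z i \<in> borel_measurable M" and i: "1 \<le> i" for Z :: "nat \<Rightarrow> 'a \<Rightarrow> real" and f :: "real \<Rightarrow> real" and i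
  proof -
    have card: "(\<lambda>\<omega>. card {l \<in> {1..n}. Z l \<omega> \<le> Z i \<omega>}) \<in> measurable M (count_space UNIV)"
    proof (rule measurable_card)
      fix l
      have "{\<omega>\<in>space M. l \<in> {l \<in> {1..n}. Z l \<omega> \<le> Z i \<omega>}}
          = (if l \<in> {1..n} then {\<omega>\<in>space M. Z l \<omega> \<le> Z i \<omega>} else {})"
        by auto
      also have "\<dots> \<in> sets M"
        using borel_measurable_le[OF Z Z[OF i], of l] by (cases "l \<in> {1..n}") auto
      finally show "{\<omega>\<in>space M. l \<in> {l \<in> {1..n}. Z l \<omega> \<le> Z i \<omega>}} \<in> sets M" .
    qed
    have "(\<lambda>c. f (real n / (real n + 1) * (real c / real n))) \<in> measurable (count_space UNIV) borel"
      unfolding measurable_count_space_eq1 by auto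
    from measurable_compose[OF card this] show ?thesis
      unfolding pseudo_obs_def emp_cdf_def .
  qed
  have K: "(\<lambda>\<omega>. kernel_cdf k ((inv \<phi> u - inv \<phi> (pseudo_obs (\<lambda>i. X i \<omega>) n i)) / h)) \<in> borel_measurable M"
    and K': "(\<lambda>\<omega>. kernel_cdf k ((inv \<phi> v - inv \<phi> (pseudo_obs (\<lambda>i. Y i \<omega>) n i)) / h)) \<in> borel_measurable M"
    if "i \<in> {1..n}" for i
    by (rule obs[of X i "\<lambda>w. kernel_cdf k ((inv \<phi> u - inv \<phi> w) / h)"]; use XY that in simp)
       (rule obs[of Y i "\<lambda>w. kernel_cdf k ((inv \<phi> v - inv \<phi> w) / h)"]; use XY that in simp)
  show ?thesis
    unfolding copula_est_def
    by (intro borel_measurable_times borel_measurable_sum borel_measurable_const K K')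
qed

context uniform_pairs
begin

text \<open>Write the centred estimator as the mean over a second sample point
  \<open>\<omega>'\<close> of the difference at \<open>\<omega>\<close> and
  \<open>\<omega>'\<close>. Both counts are compared with \<open>n * p s t\<close>, using
  \<open>E\<close> at \<open>\<omega>\<close> and the majorant \<open>W\<close> at
  \<open>\<omega>'\<close>. The constant is \<open>3 * 1304 + 3 * 978 + 4\<close>, where
  \<open>1 \<le> r\<close> absorbs the 4.\<close>

lemma copula_est_centered_le:
  fixes X Y :: "nat \<Rightarrow> 'a \<Rightarrow> real"
  assumes k: "is_kernel k" and \<phi>: "is_transformation \<phi>" and h: "0 < h" and n: "256 < n"
    and XY: "\<And>i. 1 \<le> i \<Longrightarrow> X i \<in> borel_measurable M" "\<And>i. 1 \<le> i \<Longrightarrow> Y i \<in> borel_measurable M"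
    and F: "mono F" "\<And>i \<omega>. U i \<omega> = F (X i \<omega>)" and G: "mono G" "\<And>i \<omega>. V i \<omega> = G (Y i \<omega>)"
    and E: "\<And>u v. \<bar>dev n u v \<omega>\<bar> \<le> 1304 * (sqrt (real n) * sqrt (ln (ln (real n))))"
  shows "\<bar>copula_est k \<phi> (\<lambda>i. X i \<omega>) (\<lambda>i. Y i \<omega>) n h u v
      - expectation (\<lambda>\<omega>'. copula_est k \<phi> (\<lambda>i. X i \<omega>') (\<lambda>i. Y i \<omega>') n h u v)\<bar>
    \<le> 6850 * (sqrt (real n) * sqrt (ln (ln (real n)))) * (LINT s|lebesgue. \<bar>k s\<bar>)\<^sup>2 / real n"
proof -
  define r where "r = sqrt (real n) * sqrt (ln (ln (real n)))"
  define \<kappa> where "\<kappa> = (LINT s|lebesgue. \<bar>k s\<bar>)\<^sup>2 / real n"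
  let ?C = "\<lambda>\<omega>. copula_est k \<phi> (\<lambda>i. X i \<omega>) (\<lambda>i. Y i \<omega>) n h u v"
  have n1: "1 \<le> n" using n by simp
  have \<kappa>: "0 \<le> \<kappa>" by (simp add: \<kappa>_def)
  have r: "1 \<le> r"
    using mult_mono[of 1 "sqrt (real n)" 1 "sqrt (ln (ln (real n)))"] n one_le_ln_ln[OF n] by (simp add: r_def)
  obtain W where W: "integrable M W" "\<And>u v \<omega>. \<bar>dev n u v \<omega>\<bar> \<le> W \<omega>" "expectation W \<le> 978 * r"
    using dev_dominated[OF n] unfolding r_def by metis
  have int: "integrable M ?C"
    by (rule integrable_const_bound[where B = "(LINT s|lebesgue. \<bar>k s\<bar>)\<^sup>2"])
       (auto intro!: AE_I2 copula_est_bounded[OF k \<phi> h n1] copula_est_measurable XY)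
  have diff: "\<bar>?C \<omega> - ?C \<omega>'\<bar> \<le> (3 * (1304 * r) + 3 * W \<omega>' + 4) * \<kappa>" for \<omega>'
  proof -
    have "\<bar>?C \<omega> - ?C \<omega>'\<bar> \<le> (3 * (1304 * r) + 3 * W \<omega>' + 4) * (LINT s|lebesgue. \<bar>k s\<bar>)\<^sup>2 / real n"
    proof (rule copula_est_diff_le[OF k \<phi> h n1])
      fix s t
      let ?N = "\<lambda>\<omega>. (\<Sum>i=1..n. of_bool (pseudo_obs (\<lambda>i. X i \<omega>) n i \<le> s) * of_bool (pseudo_obs (\<lambda>i. Y i \<omega>) n i \<le> t)) :: real"
      have "\<bar>?N \<omega> - real n * p s t\<bar> \<le> 3 * (1304 * r) + 2"
        unfolding r_def by (rule count_pseudo_obs[OF n1 E F G])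
      moreover have "\<bar>?N \<omega>' - real n * p s t\<bar> \<le> 3 * W \<omega>' + 2"
        by (rule count_pseudo_obs[OF n1 W(2) F G])
      ultimately show "\<bar>?N \<omega> - ?N \<omega>'\<bar> \<le> 3 * (1304 * r) + 3 * W \<omega>' + 4" by linarith
    qed
    then show ?thesis by (simp add: \<kappa>_def)
  qed
  have "?C \<omega> - expectation ?C = expectation (\<lambda>\<omega>'. ?C \<omega> - ?C \<omega>')"
    using int by (simp add: prob_space)
  then have "\<bar>?C \<omega> - expectation ?C\<bar> \<le> expectation (\<lambda>\<omega>'. \<bar>?C \<omega> - ?C \<omega>'\<bar>)"
    using integral_abs_bound[of M "\<lambda>\<omega>'. ?C \<omega> - ?C \<omega>'"] by simp
  also have "\<dots> \<le> expectation (\<lambda>\<omega>'. (3 * (1304 * r) + 3 * W \<omega>' + 4) * \<kappa>)"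
    using W(1) int by (intro integral_mono diff) auto
  also have "\<dots> = (3 * (1304 * r) + 3 * expectation W + 4) * \<kappa>"
    using W(1) by (simp add: prob_space)
  also have "\<dots> \<le> 6850 * r * \<kappa>"
    using W(3) r \<kappa> by (intro mult_right_mono) auto
  finally show ?thesis by (simp add: r_def \<kappa>_def)
qed

end

text \<open>The iterated logarithms cancel and the product is \<open>1 / sqrt 2\<close>.\<close>

lemma rate_times:
  assumes "256 < n"
  shows "0 \<le> rate n" "rate n * (sqrt (real n) * sqrt (ln (ln (real n))) / real n) \<le> 1"
proof -
  define l where "l = ln (ln (real n))"
  have l: "1 \<le> l" using one_le_ln_ln[OF assms] by (simp add: l_def)
  show "0 \<le> rate n" using l by (simp add: rate_def l_def)
  have "rate n * (sqrt (real n) * sqrt l / real n) = sqrt (real n / (2 * l) * (real n * l)) / real n"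
    by (simp only: rate_def l_def real_sqrt_mult times_divide_eq_right)
  also have "real n / (2 * l) * (real n * l) = (real n)\<^sup>2 / 2"
    using l by (simp add: power2_eq_square)
  also have "sqrt ((real n)\<^sup>2 / 2) / real n \<le> 1"
    using assms by (simp add: real_sqrt_divide divide_le_eq)
  finally show "rate n * (sqrt (real n) * sqrt (ln (ln (real n))) / real n) \<le> 1" by (simp add: l_def)
qed

theorem theorem2p1:
  fixes M :: "'a measure"
    and X Y :: "nat \<Rightarrow> 'a \<Rightarrow> real"
    and \<mu> :: "(real \<times> real) measure"
    and F G :: "real \<Rightarrow> real"
    and C :: "real \<Rightarrow> real \<Rightarrow> real"
    and k \<phi> :: "real \<Rightarrow> real"
    and b :: "nat \<Rightarrow> real"
  assumes "prob_space M"
    and "prob_space.indep_vars M (\<lambda>_. borel) (\<lambda>i \<omega>. (X i \<omega>, Y i \<omega>)) {1..}"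
    and "\<forall>i\<ge>1. distr M borel (\<lambda>\<omega>. (X i \<omega>, Y i \<omega>)) = \<mu>"
    and "F = cdf (distr \<mu> borel fst)" and "continuous_on UNIV F"
    and "G = cdf (distr \<mu> borel snd)" and "continuous_on UNIV G"
    and "is_copula C"
    and "\<forall>x y. joint_cdf \<mu> x y = C (F x) (G y)"
    and "bounded_partials C"
    and "is_kernel k"
    and "is_transformation \<phi>"
    and "bounded_deriv \<phi>"
    and "\<forall>n\<ge>1. 0 < b n \<and> b n < 1"
    and "b \<longlonglongrightarrow> 0"
    and "\<forall>\<^sub>F n in sequentially. b n \<ge> 1 / ln (real n)"
  shows "\<exists>c>0. AE \<omega> in M.
    (\<lambda>n. rate n *
      (SUP h\<in>{c * ln (real n) / real n..b n}. SUP (u, v)\<in>{0<..<1} \<times> {0<..<1}.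
        \<bar>copula_est k \<phi> (\<lambda>i. X i \<omega>) (\<lambda>i. Y i \<omega>) n h u v
         - (LINT \<omega>'|M. copula_est k \<phi> (\<lambda>i. X i \<omega>') (\<lambda>i. Y i \<omega>') n h u v)\<bar>))
    \<in> O(\<lambda>_. 1)"
proof -
  interpret prob_space M by fact
  note F = \<open>F = cdf (distr \<mu> borel fst)\<close> and G = \<open>G = cdf (distr \<mu> borel snd)\<close>
  have fst_snd [measurable]: "fst \<in> borel_measurable (borel :: (real \<times> real) measure)"
      "snd \<in> borel_measurable (borel :: (real \<times> real) measure)"
    by (auto intro!: borel_measurable_continuous_onI continuous_intros)
  have XY: "(\<lambda>\<omega>. (X i \<omega>, Y i \<omega>)) \<in> borel_measurable M" if "1 \<le> i" for i
    using assms(2) that by (auto simp: indep_vars_def)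
  have X: "X i \<in> borel_measurable M" and Y: "Y i \<in> borel_measurable M" if "1 \<le> i" for i
    using measurable_compose[OF XY[OF that] fst_snd(1)] measurable_compose[OF XY[OF that] fst_snd(2)]
    by simp_all
  have \<mu>: "\<mu> = distr M borel (\<lambda>\<omega>. (X i \<omega>, Y i \<omega>))" if "1 \<le> i" for i
    using assms(3) that by simp
  have D1: "distr \<mu> borel fst = distr M borel (X i)" and D2: "distr \<mu> borel snd = distr M borel (Y i)"
    if "1 \<le> i" for i
    using distr_distr[OF fst_snd(1) XY[OF that]] distr_distr[OF fst_snd(2) XY[OF that]]
    by (simp_all add: comp_def \<mu>[OF that])
  interpret D1: real_distribution "distr \<mu> borel fst"
    unfolding D1[OF order_refl] by (rule real_distribution_distr) (rule X, simp)
  interpret D2: real_distribution "distr \<mu> borel snd"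
    unfolding D2[OF order_refl] by (rule real_distribution_distr) (rule Y, simp)
  have mono: "mono F" "mono G"
    by (auto simp: F G mono_def D1.cdf_nondecreasing D2.cdf_nondecreasing)
  have [measurable]: "F \<in> borel_measurable borel" "G \<in> borel_measurable borel"
    using assms(5,7) by (auto intro: borel_measurable_continuous_onI)
  define p where "p u v = measure \<mu> {z. F (fst z) \<le> u \<and> G (snd z) \<le> v}" for u v
  interpret UP: uniform_pairs M "\<lambda>i \<omega>. F (X i \<omega>)" "\<lambda>i \<omega>. G (Y i \<omega>)" p
  proof
    have "indep_vars (\<lambda>_. borel) (\<lambda>i \<omega>. (\<lambda>z. (F (fst z), G (snd z))) (X i \<omega>, Y i \<omega>)) {1..}"
      by (rule indep_vars_compose2[OF assms(2)]) measurable
    then show "indep_vars (\<lambda>_. borel) (\<lambda>i \<omega>. (F (X i \<omega>), G (Y i \<omega>))) {1..}" by simp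
    show box: "prob {\<omega>\<in>space M. F (X i \<omega>) \<le> u \<and> G (Y i \<omega>) \<le> v} = p u v" if "1 \<le> i" for i u v
    proof -
      have "{z. F (fst z) \<le> u \<and> G (snd z) \<le> v} \<in> sets (borel :: (real \<times> real) measure)"
        by measurable
      then show ?thesis
        unfolding p_def \<mu>[OF that] using XY[OF that]
        by (subst measure_distr) (auto intro!: arg_cong[where f = prob])
    qed
    show unit: "F (X i \<omega>) \<in> {0..1}" "G (Y i \<omega>) \<in> {0..1}" for i \<omega>
      by (simp_all add: F G D1.cdf_nonneg D1.cdf_bounded_prob D2.cdf_nonneg D2.cdf_bounded_prob)
    fix t :: real assume t: "t \<in> {0..1}"
    \<comment> \<open>As \<open>G\<close> is at most 1 everywhere, the second constraint is void;
      the margin is then uniform by the probability integral transform.\<close>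
    have "p t 1 = prob {\<omega>\<in>space M. F (X 1 \<omega>) \<le> t}"
      using unit(2) by (simp flip: box[of 1])
    also have "\<dots> = measure (distr \<mu> borel fst) {x. F x \<le> t}"
      unfolding D1[OF order_refl] using X[OF order_refl]
      by (subst measure_distr) (auto intro!: arg_cong[where f = prob])
    also have "\<dots> = t"
      unfolding F by (rule D1.measure_cdf_le[OF _ t]) (use assms(5) F in simp)
    finally show "p t 1 = t" .
    have "p 1 t = prob {\<omega>\<in>space M. G (Y 1 \<omega>) \<le> t}"
      using unit(1) by (simp flip: box[of 1])
    also have "\<dots> = measure (distr \<mu> borel snd) {x. G x \<le> t}"
      unfolding D2[OF order_refl] using Y[OF order_refl]
      by (subst measure_distr) (auto intro!: arg_cong[where f = prob])
    also have "\<dots> = t"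
      unfolding G by (rule D2.measure_cdf_le[OF _ t]) (use assms(7) G in simp)
    finally show "p 1 t = t" .
  qed
  define \<kappa> where "\<kappa> = (LINT s|lebesgue. \<bar>k s\<bar>)\<^sup>2"
  have \<kappa>: "0 \<le> \<kappa>" by (simp add: \<kappa>_def)
  \<comment> \<open>With \<open>n\<close> written as \<open>exp (ln n)\<close> this yields
    \<open>ln n / n \<le> 1 / ln n \<le> b n\<close> eventually: the range of \<open>h\<close> is
    nonempty, so that the real supremum is meaningful.\<close>
  have "(\<lambda>n. ln (real n) ^ 2 / exp (ln (real n))) \<longlonglongrightarrow> 0"
    by (rule filterlim_compose[OF tendsto_power_div_exp_0 filterlim_compose[OF ln_at_top filterlim_real_sequentially]])
  then have "\<forall>\<^sub>F n in sequentially. ln (real n) ^ 2 / exp (ln (real n)) < 1"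
    by (rule order_tendstoD) simp
  then have nonempty: "\<forall>\<^sub>F n in sequentially. 1 * ln (real n) / real n \<le> b n"
    using assms(16) eventually_gt_at_top[of 1]
  proof eventually_elim
    case (elim n)
    then have "ln (real n) / real n \<le> 1 / ln (real n)" by (simp add: le_divide_eq power2_eq_square)
    with elim show ?case by simp
  qed
  \<comment> \<open>The witness is \<open>c = 1\<close>. The estimate is uniform over all positive
    \<open>h\<close>, so the lower end of the range only has to be positive and eventually at most
    \<open>b n\<close>.\<close>
  have "AE \<omega> in M.
    (\<lambda>n. rate n *
      (SUP h\<in>{1 * ln (real n) / real n..b n}. SUP (u, v)\<in>{0<..<1} \<times> {0<..<1}.
        \<bar>copula_est k \<phi> (\<lambda>i. X i \<omega>) (\<lambda>i. Y i \<omega>) n h u v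
         - (LINT \<omega>'|M. copula_est k \<phi> (\<lambda>i. X i \<omega>') (\<lambda>i. Y i \<omega>') n h u v)\<bar>))
    \<in> O(\<lambda>_. 1)"
    using UP.AE_dev_bound
  proof (rule AE_mp, intro AE_I2 impI)
    fix \<omega>
    let ?d = "\<lambda>n h u v. \<bar>copula_est k \<phi> (\<lambda>i. X i \<omega>) (\<lambda>i. Y i \<omega>) n h u v
         - (LINT \<omega>'|M. copula_est k \<phi> (\<lambda>i. X i \<omega>') (\<lambda>i. Y i \<omega>') n h u v)\<bar>"
    let ?S = "\<lambda>n. SUP h\<in>{1 * ln (real n) / real n..b n}. SUP (u, v)\<in>{0<..<1} \<times> {0<..<1}. ?d n h u v"
    assume "\<forall>\<^sub>F n in sequentially. \<forall>u v.
      \<bar>UP.dev n u v \<omega>\<bar> \<le> 1304 * (sqrt (real n) * sqrt (ln (ln (real n))))"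
    then have "\<forall>\<^sub>F n in sequentially. norm (rate n * ?S n) \<le> 6850 * \<kappa> * norm (1::real)"
      using nonempty eventually_gt_at_top[of 256]
    proof eventually_elim
      case (elim n)
      then have E: "\<bar>UP.dev n u v \<omega>\<bar> \<le> 1304 * (sqrt (real n) * sqrt (ln (ln (real n))))" for u v
        by blast
      let ?B = "6850 * (sqrt (real n) * sqrt (ln (ln (real n)))) * \<kappa> / real n"
      have S: "\<bar>?S n\<bar> \<le> ?B"
      proof (rule cSup_abs_le)
        show "(\<lambda>h. SUP (u, v)\<in>{0<..<1} \<times> {0<..<1}. ?d n h u v) ` {1 * ln (real n) / real n..b n} \<noteq> {}"
          using elim(2) by simp
        fix y assume "y \<in> (\<lambda>h. SUP (u, v)\<in>{0<..<1} \<times> {0<..<1}. ?d n h u v) ` {1 * ln (real n) / real n..b n}"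
        then obtain h where h: "1 * ln (real n) / real n \<le> h"
          and y: "y = (SUP (u, v)\<in>{0<..<1} \<times> {0<..<1}. ?d n h u v)" by auto
        have "0 < 1 * ln (real n) / real n" using elim(3) by simp
        with h have h0: "0 < h" by linarith
        show "\<bar>y\<bar> \<le> ?B"
          unfolding y
        proof (rule cSup_abs_le)
          show "(\<lambda>(u, v). ?d n h u v) ` ({0<..<1} \<times> {0<..<1}) \<noteq> {}" by simp
          fix w assume "w \<in> (\<lambda>(u, v). ?d n h u v) ` ({0<..<1} \<times> {0<..<1})"
          then obtain u v where w: "w = ?d n h u v" by auto
          have "?d n h u v \<le> ?B"
            unfolding \<kappa>_def
            by (rule UP.copula_est_centered_le[OF assms(11,12) h0 elim(3) X Y mono(1) refl mono(2) refl E])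
          then show "\<bar>w\<bar> \<le> ?B" by (simp add: w)
        qed
      qed
      have "norm (rate n * ?S n) = rate n * \<bar>?S n\<bar>"
        using rate_times(1)[OF elim(3)] by (simp add: abs_mult)
      also have "\<dots> \<le> rate n * ?B"
        by (rule mult_left_mono[OF S rate_times(1)[OF elim(3)]])
      also have "\<dots> = 6850 * \<kappa> * (rate n * (sqrt (real n) * sqrt (ln (ln (real n))) / real n))" by simp
      also have "\<dots> \<le> 6850 * \<kappa> * 1"
        using rate_times(2)[OF elim(3)] \<kappa> by (intro mult_left_mono) auto
      finally show ?case by simp
    qed
    then show "(\<lambda>n. rate n * ?S n) \<in> O(\<lambda>_. 1)" by (rule bigoI)
  qed
  then show ?thesis by (intro exI[of _ 1]) simp
qed

end
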